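(* For every infinite cardinal $\lambda$ there is a $T_3$ topological space $X$ which has a basis consisting of clopen sets, such that $|X| = 2^{2^\lambda}$ and every closed subset $Y \subseteq X$ with $|Y| \ge \lambda$ satisfies $|Y| = |X|$. *)

theory Defs
  imports "HOL-Analysis.Analysis"
begin

unbundle cardinal_syntax

text \<open>The library's \<^const>\<open>regular_space\<close> does not include any separation of points, hence the
  \<^const>\<open>t1_space\<close> conjunct.\<close>

definition T3_space :: "'a topology \<Rightarrow> bool" where
  "T3_space X \<longleftrightarrow> t1_space X \<and> regular_space X"

definition has_clopen_basis :: "'a topology \<Rightarrow> bool" where
  "has_clopen_basis X \<longleftrightarrow>
     (\<exists>\<B>. (\<forall>U\<in>\<B>. openin X U \<and> closedin X U) \<and>
          openin X = arbitrary union_of (\<lambda>U. U \<in> \<B>))"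

end

(* Let L be a set of cardinality kappa. The points of X are well-founded terms: the free nodes, and a
   node Limit j A for every injective family A of nodes indexed by L and every j in Pow (Pow L). A node
   t = Limit j A carries its own ultrafilter p_t on L, and a set of nodes is declared clopen when, for
   every such t, it contains t iff it contains A x for p_t-many x. Then every family of kappa points has
   2^(2^kappa) limit points, and the only difficulty is to separate points. This works because the
   ultrafilters p_t can be chosen such that for any kappa many nodes t there are sets E_t in p_t for
   which the images of the E_t under the respective families are pairwise disjoint: the relation from t
   to the points A x, x in E_t, is then a forest, and the part of the forest below a point is clopen.

   To obtain such ultrafilters, take a filter base J on L that makes conflicts between different
   families negligible and a partition of L into kappa many J-positive pieces, and let p_t prescribe the
   values of an independent family of functions on the pieces. For uncountable kappa, J is generated by
   club-like sets, and the partition comes from an Ulam matrix in each interval [mu, mu^+) of ordinals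
   below kappa; for countable kappa one uses finite blocks of rapidly increasing size. *)

theory Submission
  imports Defs
begin

subsection \<open>Cardinality bounds\<close>

lemma card_of_UN2_ordLeq:
  assumes "infinite K" "|A| \<le>o |K|" "|B| \<le>o |K|" "\<And>a b. a \<in> A \<Longrightarrow> b \<in> B \<Longrightarrow> |f a b| \<le>o |K|"
  shows "|\<Union>a\<in>A. \<Union>b\<in>B. f a b| \<le>o |K|"
  using assms by (intro card_of_UNION_ordLeq_infinite ballI) auto

lemma finite_card_ordLeq: "finite A \<Longrightarrow> infinite K \<Longrightarrow> |A| \<le>o |K|"
  by (metis card_of_Well_order card_of_ordLeq_finite ordLeq_total)

lemma card_ordLeq_refl: "|A| \<le>o |A|"
  by (simp add: card_of_mono1)

lemma card_insert_ordLeq: "infinite K \<Longrightarrow> |A| \<le>o |K| \<Longrightarrow> |insert a A| \<le>o |K|"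
  using card_of_Un_ordLeq_infinite_Field[OF _ finite_card_ordLeq _ card_of_Card_order, of K "{a}" A]
  by (simp add: Field_card_of)

lemma card_of_ordLeqI: "inj_on f A \<Longrightarrow> f ` A \<subseteq> B \<Longrightarrow> |A| \<le>o |B|"
  using card_of_ordLeq[of A B] by auto

lemma card_of_ordLeqE:
  assumes "|A| \<le>o |B|"
  obtains f where "inj_on f A" "f ` A \<subseteq> B"
  using assms card_of_ordLeq[of A B] by auto

lemma card_of_Times_ordLeq_infinite:
  "infinite L \<Longrightarrow> |A| \<le>o |L| \<Longrightarrow> |B| \<le>o |L| \<Longrightarrow> |A \<times> B| \<le>o |L|"
  by (intro card_of_Sigma_ordLeq_infinite ballI)

lemma card_of_lists_ordLeq:
  assumes "infinite L"
  shows "|lists L| \<le>o |L|"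
proof -
  have "|{xs \<in> lists L. length xs = n}| \<le>o |L|" for n
  proof (induction n)
    case 0
    have "{xs \<in> lists L. length xs = 0} = {[]}" by auto
    then show ?case using finite_card_ordLeq[OF _ assms] by (metis finite.emptyI finite_insert)
  next
    case (Suc n)
    have "{xs \<in> lists L. length xs = Suc n} \<subseteq> (\<lambda>(x, xs). x # xs) ` (L \<times> {xs \<in> lists L. length xs = n})"
    proof
      fix xs assume "xs \<in> {xs \<in> lists L. length xs = Suc n}"
      then show "xs \<in> (\<lambda>(x, xs). x # xs) ` (L \<times> {xs \<in> lists L. length xs = n})"
        by (cases xs) auto
    qed
    then have "|{xs \<in> lists L. length xs = Suc n}| \<le>o |L \<times> {xs \<in> lists L. length xs = n}|"
      by (rule ordLeq_transitive[OF card_of_mono1 card_of_image])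
    moreover have "|L \<times> {xs \<in> lists L. length xs = n}| \<le>o |L|"
      using card_of_Times_ordLeq_infinite[OF assms card_ordLeq_refl Suc] .
    ultimately show ?case by (rule ordLeq_transitive)
  qed
  moreover have "|UNIV :: nat set| \<le>o |L|" using assms infinite_iff_card_of_nat by blast
  ultimately have "|\<Union>n. {xs \<in> lists L. length xs = n}| \<le>o |L|"
    using assms by (intro card_of_UNION_ordLeq_infinite ballI)
  moreover have "(\<Union>n. {xs \<in> lists L. length xs = n}) = lists L" by auto
  ultimately show ?thesis by simp
qed

lemma card_of_Fpow_ordLeq:
  assumes "infinite L"
  shows "|Fpow L| \<le>o |L|"
proof -
  have "Fpow L \<subseteq> set ` lists L"
    using finite_list by (force simp: Fpow_def)
  then have "|Fpow L| \<le>o |lists L|"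
    using ordLeq_transitive[OF card_of_mono1 card_of_image] by blast
  then show ?thesis using card_of_lists_ordLeq[OF assms] ordLeq_transitive by blast
qed

subsection \<open>A filter base with a positive partition\<close>

text \<open>Only the kernel of \<open>F\<close> matters below, so functions with values in \<open>'a set\<close> represent functions
  with values in an arbitrary type.\<close>

definition separating_base :: "'a set \<Rightarrow> 'a set set \<Rightarrow> ('a \<Rightarrow> 'a) \<Rightarrow> bool" where
  "separating_base L J g \<longleftrightarrow>
     J \<subseteq> Pow L \<and> (\<forall>A\<in>J. \<forall>B\<in>J. A \<inter> B \<in> J) \<and> (\<forall>x\<in>L. L - {x} \<in> J) \<and>
     (\<forall>C\<in>J. \<forall>x\<in>L. \<exists>v\<in>C. g v = x) \<and>
     (\<forall>h. \<forall>F :: 'a \<Rightarrow> 'a set. (\<forall>z\<in>L. inj_on F {v \<in> L. h (g v) = z}) \<longrightarrow>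
        (\<exists>C. (\<forall>z\<in>L. C z \<in> J) \<and> inj_on F {v \<in> L. h (g v) \<in> L \<and> v \<in> C (h (g v))}))"

text \<open>\<open>S x\<close> is the set of predecessors of \<open>x\<close> in a well-ordering of
  \<open>L\<close> of least possible order type; the last axiom expresses this minimality.\<close>

locale card_segments =
  fixes L :: "'a set" and S :: "'a \<Rightarrow> 'a set"
  assumes S_sub: "S x \<subseteq> L" and S_irrefl: "x \<notin> S x"
    and S_total: "x \<in> L \<Longrightarrow> y \<in> L \<Longrightarrow> x \<in> S y \<or> x = y \<or> y \<in> S x"
    and S_trans: "x \<in> S y \<Longrightarrow> y \<in> S z \<Longrightarrow> x \<in> S z"
    and S_least: "A \<subseteq> L \<Longrightarrow> A \<noteq> {} \<Longrightarrow> \<exists>m\<in>A. \<forall>y\<in>A. y \<notin> S m"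
    and S_card: "x \<in> L \<Longrightarrow> |S x| <o |L|"

lemma card_segments_exists:
  fixes L :: "'a set"
  assumes "infinite L"
  shows "\<exists>S. card_segments L S"
proof -
  define r where "r = |L|"
  have co: "Card_order r" and F: "Field r = L"
    unfolding r_def by (rule card_of_Card_order, rule Field_card_of)
  have wo: "wo_rel r"
    unfolding wo_rel_def using co by (simp add: card_order_on_def)
  show ?thesis
  proof (intro exI[of _ "underS r"] card_segments.intro)
    show "underS r x \<subseteq> L" for x
      using F by (auto simp: underS_def Field_def)
    show "x \<notin> underS r x" for x
      by (simp add: underS_def)
    show "x \<in> underS r y \<or> x = y \<or> y \<in> underS r x" if "x \<in> L" "y \<in> L" for x y
      using wo_rel.TOTALS[OF wo] F that by (auto simp: underS_def)
    show "x \<in> underS r z" if "x \<in> underS r y" "y \<in> underS r z" for x y z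
      using that wo_rel.TRANS[OF wo] wo_rel.ANTISYM[OF wo] unfolding underS_def trans_def antisym_def by blast
    show "\<exists>m\<in>A. \<forall>y\<in>A. y \<notin> underS r m" if "A \<subseteq> L" "A \<noteq> {}" for A
    proof -
      have A: "A \<le> Field r" using that F by simp
      have m: "wo_rel.minim r A \<in> A" using wo_rel.minim_in[OF wo, OF A that(2)] .
      have "y \<notin> underS r (wo_rel.minim r A)" if "y \<in> A" for y
        using wo_rel.minim_least[OF wo, OF A that] wo_rel.ANTISYM[OF wo] that unfolding underS_def antisym_def by blast
      with m show ?thesis by blast
    qed
    show "|underS r x| <o |L|" if "x \<in> L" for x
      using card_of_underS[OF co] that F unfolding r_def by (simp add: Field_card_of)
  qed
qed

section \<open>Closure points and stationary sets in the intervals between successive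
  cardinals\<close>

context card_segments
begin

text \<open>For infinite \<open>S a\<close>, the set \<open>V a\<close> is an initial segment of order type \<open>|S a|\<^sup>+\<close>.\<close>

definition V :: "'a \<Rightarrow> 'a set" where
  "V a = {x \<in> L. |S x| \<le>o |S a|}"

text \<open>Restricting the closure condition to \<open>V x\<close>, i.e. to values whose cardinality does not exceed
  that of \<open>x\<close>, keeps these sets nonempty for every uncountable \<open>L\<close>, singular cardinalities included.\<close>

definition closed_under :: "('a \<Rightarrow> 'a \<Rightarrow> 'a set) \<Rightarrow> 'a \<Rightarrow> 'a set" where
  "closed_under \<phi> d = {x \<in> L. d \<in> S x \<and> (\<forall>v\<in>S x. \<forall>z\<in>S x. \<phi> v z \<inter> V x \<subseteq> S x)}"

lemma V_sub: "V a \<subseteq> L"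
  by (auto simp: V_def)

lemma V_refl: "a \<in> L \<Longrightarrow> a \<in> V a"
  by (simp add: V_def card_ordLeq_refl)

lemma S_mono: "x \<in> S y \<Longrightarrow> S x \<subseteq> S y"
  using S_trans by blast

lemma V_S: "x \<in> S y \<Longrightarrow> x \<in> V y"
  using S_sub card_of_mono1[OF S_mono] unfolding V_def by blast

lemma V_mono: "x \<in> V y \<Longrightarrow> V x \<subseteq> V y"
  using ordLeq_transitive by (auto simp: V_def)

text \<open>\<open>V\<close> is constant on each interval between a cardinal and its successor. Thus
  a point determines the interval whose partition applies to it.\<close>

lemma V_eq:
  assumes "d \<in> V a" "a \<in> S d" "d \<in> L"
  shows "V d = V a"
  using assms V_mono V_S by blast

text \<open>Regularity of the successor cardinal: the downward closure of \<open>B\<close> has size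
  at most \<open>|S a|\<close>, whereas \<open>V a\<close> is larger, so some point of
  \<open>V a\<close> lies above all of \<open>B\<close>.\<close>

lemma V_bounded:
  assumes a: "a \<in> L" "infinite (S a)" and B: "B \<subseteq> V a" "|B| \<le>o |S a|"
  obtains v where "v \<in> V a" "B \<subseteq> S v"
proof -
  define T where "T = (\<Union>b\<in>B. insert b (S b))"
  have T: "|T| \<le>o |S a|"
    unfolding T_def using B a
    by (intro card_of_UNION_ordLeq_infinite ballI card_insert_ordLeq) (auto simp: V_def)
  \<comment> \<open>If \<open>V a\<close> were small, a least point outside it would have its
    segment inside \<open>V a\<close>, hence a small segment, and so belong to \<open>V a\<close>.
    If there is no point outside, \<open>S_card\<close> is violated.\<close>
  have "\<not> V a \<subseteq> T"
  proof
    assume "V a \<subseteq> T"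
    then have VS: "|V a| \<le>o |S a|"
      using T ordLeq_transitive card_of_mono1 by blast
    show False
    proof (cases "V a = L")
      case True
      then show ?thesis
        using VS S_card[OF a(1)] not_ordLess_ordLeq by metis
    next
      case False
      then have "L - V a \<noteq> {}" using V_sub by blast
      then obtain m where m: "m \<in> L - V a" "\<forall>y\<in>L - V a. y \<notin> S m"
        using S_least[of "L - V a"] by blast
      then have "S m \<subseteq> V a" using S_sub by blast
      then have "|S m| \<le>o |S a|"
        using VS ordLeq_transitive card_of_mono1 by blast
      with m show False by (auto simp: V_def)
    qed
  qed
  then obtain v where v: "v \<in> V a" "v \<notin> T" by blast
  have "B \<subseteq> S v"
  proof
    fix b assume b: "b \<in> B"
    have "v \<notin> insert b (S b)" using v(2) b unfolding T_def by blast
    then show "b \<in> S v" using S_total[of b v] b B(1) V_sub v(1) by blast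
  qed
  with v that show thesis by blast
qed

text \<open>One point serves \<open>|S a|\<close> many closure conditions at once. It is the limit
  of an omega-sequence in \<open>V a\<close>, each term of which bounds the values of all the
  operations at arguments up to the preceding term.\<close>

lemma closing_off:
  assumes a: "a \<in> L" "infinite (S a)" and b: "b \<in> V a"
    and d: "\<And>k. k \<in> S a \<Longrightarrow> d k \<in> V a"
    and fin: "\<And>k v z. finite (\<phi> k v z)"
  obtains x where "x \<in> V a" "b \<in> S x" "\<And>k. k \<in> S a \<Longrightarrow> x \<in> closed_under (\<phi> k) (d k)"
proof -
  define K where "K = S a"
  have K: "infinite K" using a by (simp add: K_def)
  have SK: "|S v| \<le>o |K|" if "v \<in> V a" for v using that by (simp add: V_def K_def)
  define N where "N u = insert u (\<Union>k\<in>K. \<Union>v\<in>insert u (S u). \<Union>z\<in>insert u (S u). \<phi> k v z \<inter> V a)" for u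
  have step: "\<exists>v. v \<in> V a \<and> N u \<subseteq> S v" if u: "u \<in> V a" for u
  proof -
    have "|N u| \<le>o |K|"
      unfolding N_def using K SK[OF u] fin
      by (intro card_insert_ordLeq card_of_UNION_ordLeq_infinite card_of_UN2_ordLeq ballI)
         (auto intro: finite_card_ordLeq card_of_mono1)
    moreover have "N u \<subseteq> V a" using u by (auto simp: N_def)
    ultimately show ?thesis using V_bounded[OF a, of "N u"] unfolding K_def by metis
  qed
  have "|insert b (d ` K)| \<le>o |K|" using K card_of_image by (intro card_insert_ordLeq) auto
  moreover have "insert b (d ` K) \<subseteq> V a" using b d by (auto simp: K_def)
  ultimately obtain b0 where b0: "b0 \<in> V a" "insert b (d ` K) \<subseteq> S b0"
    using V_bounded[OF a, of "insert b (d ` K)"] unfolding K_def by metis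
  obtain s where s: "\<And>n. s n \<in> V a" "s 0 = b0" "\<And>n. N (s n) \<subseteq> S (s (Suc n))"
  proof -
    define s where "s = rec_nat b0 (\<lambda>_ u. SOME v. v \<in> V a \<and> N u \<subseteq> S v)"
    have s0: "s 0 = b0" and sS: "s (Suc n) = (SOME v. v \<in> V a \<and> N (s n) \<subseteq> S v)" for n
      by (simp_all add: s_def)
    have sV: "s n \<in> V a" for n
    proof (induction n)
      case 0 then show ?case using s0 b0 by simp
    next
      case (Suc n) then show ?case using someI_ex[OF step[OF Suc]] sS by simp
    qed
    have "N (s n) \<subseteq> S (s (Suc n))" for n
      using someI_ex[OF step[OF sV]] sS by simp
    with sV s0 that show thesis by blast
  qed
  have sm: "s n \<in> S (s (Suc n))" for n using s(3)[of n] by (auto simp: N_def)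
  have sm2: "m < n \<Longrightarrow> s m \<in> S (s n)" for m n
  proof (induction n)
    case (Suc n)
    then show ?case using sm[of n] S_trans by (metis less_antisym)
  qed simp
  \<comment> \<open>The least bound of the sequence in \<open>V a\<close> is its limit: everything
    below it lies at or below some \<open>s n\<close>.\<close>
  define B where "B = {x \<in> V a. range s \<subseteq> S x}"
  have "|range s| \<le>o |K|"
    using K ordLeq_transitive[OF card_of_image] infinite_iff_card_of_nat[of K] by auto
  moreover have "range s \<subseteq> V a" using s(1) by blast
  ultimately obtain u where "u \<in> V a" "range s \<subseteq> S u"
    using V_bounded[OF a, of "range s"] unfolding K_def by metis
  then have "B \<noteq> {}" unfolding B_def by blast
  moreover have "B \<subseteq> L" using V_sub unfolding B_def by blast
  ultimately obtain x where x: "x \<in> B" "\<forall>y\<in>B. y \<notin> S x"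
    using S_least[of B] by blast
  have xV: "x \<in> V a" and sx: "\<And>n. s n \<in> S x" using x by (auto simp: B_def)
  have below: "\<exists>n. v \<in> insert (s n) (S (s n))" if v: "v \<in> S x" for v
  proof -
    have "v \<in> V a" using V_mono[OF xV] V_S[OF v] by blast
    moreover have "v \<notin> B" using x v by blast
    ultimately obtain n where "s n \<notin> S v" by (auto simp: B_def)
    then show ?thesis
      using S_total[of v "s n"] subsetD[OF S_sub v] subsetD[OF V_sub s(1)] by auto
  qed
  have up: "v \<in> insert (s n) (S (s n))" if "v \<in> insert (s m) (S (s m))" "m \<le> n" for v m n
    using that sm2[of m n] S_trans by (cases "m = n") auto
  have cl: "\<phi> k v z \<inter> V x \<subseteq> S x" if k: "k \<in> K" and v: "v \<in> S x" and z: "z \<in> S x" for k v z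
  proof -
    obtain m n where "v \<in> insert (s m) (S (s m))" "z \<in> insert (s n) (S (s n))"
      using below v z by meson
    then have "v \<in> insert (s (max m n)) (S (s (max m n)))" "z \<in> insert (s (max m n)) (S (s (max m n)))"
      using up by (meson max.cobounded1 max.cobounded2)+
    then have "\<phi> k v z \<inter> V a \<subseteq> N (s (max m n))" using k unfolding N_def by blast
    then show ?thesis using s(3) sx S_trans V_mono[OF xV] by blast
  qed
  have b0x: "b0 \<in> S x" using sx[of 0] s(2) by simp
  show thesis
  proof (rule that[OF xV])
    show "b \<in> S x" using b0 b0x S_trans by blast
    show "x \<in> closed_under (\<phi> k) (d k)" if "k \<in> S a" for k
    proof -
      have "d k \<in> S x" using that b0 b0x S_trans unfolding K_def by blast
      then show ?thesis
        using that cl[of k] xV V_sub unfolding K_def closed_under_def by blast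
    qed
  qed
qed

text \<open>An Ulam matrix: \<open>e y\<close> injects \<open>S y\<close> into \<open>S a\<close>, and \<open>U k b\<close> collects the points \<open>y > b\<close>
  with \<open>e y b = k\<close>.\<close>

lemma stationary_partition:
  assumes a: "a \<in> L" "infinite (S a)"
  shows "\<exists>g. \<forall>\<phi> d x. (\<forall>v z. finite (\<phi> v z)) \<longrightarrow> d \<in> V a \<longrightarrow> x \<in> V a \<longrightarrow>
           (\<exists>y\<in>closed_under \<phi> d. V y = V a \<and> g y = x)"
proof -
  define K where "K = S a"
  have K: "infinite K" using a by (simp add: K_def)
  \<comment> \<open>Stationarity in \<open>V a\<close>, with the sets
    \<open>closed_under \<phi> d\<close> in the role of the clubs.\<close>
  define stat where "stat A \<longleftrightarrow> (\<forall>\<phi> d. (\<forall>v z. finite (\<phi> v z)) \<longrightarrow> d \<in> V a \<longrightarrow>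
      A \<inter> closed_under \<phi> d \<noteq> {})" for A :: "'a set"
  have "\<exists>e. inj_on e (S y) \<and> e ` S y \<subseteq> K" if "y \<in> V a" for y
    using that card_of_ordLeq[of "S y" K] by (simp add: V_def K_def)
  then obtain e where e: "\<And>y. y \<in> V a \<Longrightarrow> inj_on (e y) (S y) \<and> e y ` S y \<subseteq> K"
    by metis
  define U where "U k b = {y \<in> V a. b \<in> S y \<and> e y b = k}" for k b
  \<comment> \<open>Otherwise a common closure point \<open>x\<close> above \<open>b\<close> of the
    counterexamples for all \<open>k\<close> would lie in \<open>U (e x b) b\<close>, contradicting
    the choice for \<open>k = e x b\<close>.\<close>
  have "\<exists>k\<in>K. stat (U k b)" if b: "b \<in> V a" for b
  proof (rule ccontr)
    assume "\<not> (\<exists>k\<in>K. stat (U k b))"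
    then have "\<forall>k. \<exists>\<phi> d. k \<in> K \<longrightarrow> (\<forall>v z. finite (\<phi> v z)) \<and> d \<in> V a \<and> U k b \<inter> closed_under \<phi> d = {}"
      unfolding stat_def by blast
    then obtain \<phi> d where \<phi>d: "\<And>k. k \<in> K \<Longrightarrow> (\<forall>v z. finite (\<phi> k v z)) \<and> d k \<in> V a \<and>
        U k b \<inter> closed_under (\<phi> k) (d k) = {}" by metis
    define \<phi>' where "\<phi>' k v z = (if k \<in> K then \<phi> k v z else {})" for k v z
    have "finite (\<phi>' k v z)" for k v z using \<phi>d by (simp add: \<phi>'_def)
    then obtain x where x: "x \<in> V a" "b \<in> S x" "\<And>k. k \<in> K \<Longrightarrow> x \<in> closed_under (\<phi>' k) (d k)"
      using closing_off[OF a b, of d \<phi>'] \<phi>d unfolding K_def by metis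
    have k: "e x b \<in> K" using e[OF x(1)] x(2) by blast
    then have "x \<in> closed_under (\<phi> (e x b)) (d (e x b))"
      using x(3)[OF k] by (simp add: \<phi>'_def closed_under_def)
    moreover have "x \<in> U (e x b) b" using x by (simp add: U_def)
    ultimately show False using \<phi>d[OF k] by blast
  qed
  then obtain \<kappa> where \<kappa>: "\<And>b. b \<in> V a \<Longrightarrow> \<kappa> b \<in> K \<and> stat (U (\<kappa> b) b)" by metis
  have notK: "\<not> |V a| \<le>o |K|"
  proof
    assume "|V a| \<le>o |K|"
    then obtain v where "v \<in> V a" "V a \<subseteq> S v"
      using V_bounded[OF a, of "V a"] unfolding K_def by (metis order_refl)
    then show False using S_irrefl by blast
  qed
  \<comment> \<open>Pigeonhole: more than \<open>|K|\<close> points \<open>b\<close> share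
    \<open>|K|\<close> values of \<open>\<kappa>\<close>, so one value occurs more than
    \<open>|K|\<close> times.\<close>
  obtain k where k: "k \<in> K" "\<not> |{b \<in> V a. \<kappa> b = k}| \<le>o |K|"
  proof (rule ccontr)
    assume "\<not> thesis"
    then have "\<forall>k\<in>K. |{b \<in> V a. \<kappa> b = k}| \<le>o |K|" using that by blast
    then have "|\<Union>k\<in>K. {b \<in> V a. \<kappa> b = k}| \<le>o |K|"
      using K by (intro card_of_UNION_ordLeq_infinite) (auto simp: card_of_mono1)
    moreover have "(\<Union>k\<in>K. {b \<in> V a. \<kappa> b = k}) = V a" using \<kappa> by auto
    ultimately show False using notK by simp
  qed
  define N where "N = {b \<in> V a. \<kappa> b = k}"
  have KN: "|K| \<le>o |N|"
    using k(2) ordLess_or_ordLeq[OF card_of_Well_order card_of_Well_order, of K N]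
    by (auto simp: N_def intro: ordLess_imp_ordLeq)
  have infN: "infinite N" using KN K card_of_ordLeq_infinite by blast
  \<comment> \<open>A bound of \<open>N\<close> in \<open>V a\<close> would have more than
    \<open>|K|\<close> predecessors. So \<open>N\<close> is cofinal, hence as large as
    \<open>V a\<close>, and its stationary sets can be labelled by all points of
    \<open>V a\<close>.\<close>
  have "V a \<subseteq> (\<Union>b\<in>N. insert b (S b))"
  proof
    fix v assume v: "v \<in> V a"
    show "v \<in> (\<Union>b\<in>N. insert b (S b))"
    proof (rule ccontr)
      assume "v \<notin> (\<Union>b\<in>N. insert b (S b))"
      then have "b \<in> S v" if "b \<in> N" for b
        using S_total[of b v] v V_sub that unfolding N_def by blast
      then have "N \<subseteq> S v" by blast
      then have "|N| \<le>o |K|"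
        using v ordLeq_transitive[OF card_of_mono1, of N "S v"] by (auto simp: V_def K_def)
      with k show False by (simp add: N_def)
    qed
  qed
  moreover have "|\<Union>b\<in>N. insert b (S b)| \<le>o |N|"
  proof (intro card_of_UNION_ordLeq_infinite ballI card_insert_ordLeq infN card_ordLeq_refl)
    show "|S b| \<le>o |N|" if "b \<in> N" for b
      using that KN ordLeq_transitive by (auto simp: N_def V_def K_def)
  qed
  ultimately have "|V a| \<le>o |N|"
    using ordLeq_transitive card_of_mono1 by blast
  then obtain m where m: "inj_on m (V a)" "m ` V a \<subseteq> N"
    using card_of_ordLeq[of "V a" N] by blast
  have uniq: "x' = x" if "x \<in> V a" "y \<in> U k (m x)" "x' \<in> V a" "y \<in> U k (m x')" for x x' y
  proof -
    have y: "y \<in> V a" "m x \<in> S y" "m x' \<in> S y" "e y (m x') = e y (m x)"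
      using that unfolding U_def by simp_all
    have "m x' = m x"
      using inj_onD[OF conjunct1[OF e[OF y(1)]] y(4,3,2)] .
    then show ?thesis using inj_onD[OF m(1)] that by blast
  qed
  define g where "g y = (THE x. x \<in> V a \<and> y \<in> U k (m x))" for y
  have g: "g y = x" if xy: "x \<in> V a" "y \<in> U k (m x)" for x y
    unfolding g_def by (rule the_equality) (use xy uniq[OF xy] in blast)+
  show ?thesis
  proof (intro exI[of _ g] allI impI)
    fix \<phi> :: "'a \<Rightarrow> 'a \<Rightarrow> 'a set" and d x
    assume fin: "\<forall>v z. finite (\<phi> v z)" and d: "d \<in> V a" and x: "x \<in> V a"
    \<comment> \<open>Including \<open>a\<close> places \<open>y\<close> above \<open>a\<close>,
      which forces \<open>V y = V a\<close>.\<close>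
    obtain d' where d': "d' \<in> V a" "{a, d} \<subseteq> S d'"
      using V_bounded[OF a, of "{a, d}"] d V_refl[OF a(1)] a(2) finite_card_ordLeq[of "{a,d}"]
      by blast
    have "stat (U k (m x))" using \<kappa> m x by (auto simp: N_def)
    then obtain y where y: "y \<in> U k (m x)" "y \<in> closed_under \<phi> d'"
      using fin d'(1) unfolding stat_def by blast
    have ay: "a \<in> S y" and dy: "d \<in> S y"
      using y(2) d'(2) S_trans by (auto simp: closed_under_def)
    have "y \<in> closed_under \<phi> d" using y(2) dy by (simp add: closed_under_def)
    moreover have "V y = V a" using V_eq[OF _ ay] y V_sub by (auto simp: U_def)
    moreover have "g y = x" using g[OF x y(1)] .
    ultimately show "\<exists>y\<in>closed_under \<phi> d. V y = V a \<and> g y = x" by blast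
  qed
qed

text \<open>If all segments were finite, a countably infinite \<open>B\<close> would have a
  countable downward closure, and a point outside it would lie above all of
  \<open>B\<close>.\<close>

lemma infinite_segment:
  assumes "uncountable L"
  obtains a where "a \<in> L" "infinite (S a)"
proof -
  have "infinite L" using assms countable_finite by blast
  then obtain B where B: "B \<subseteq> L" "countable B" "infinite B"
    using infinite_countable_subset' by blast
  show thesis
  proof (rule ccontr)
    assume "\<not> thesis"
    with that have fin: "finite (S a)" if "a \<in> L" for a using that by blast
    have "countable (\<Union>b\<in>B. insert b (S b))"
    proof (intro countable_UN B(2) countable_insert countable_finite)
      show "finite (S b)" if "b \<in> B" for b using fin that B(1) by blast
    qed
    then have "\<not> L \<subseteq> (\<Union>b\<in>B. insert b (S b))"
      using assms countable_subset by metis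
    then obtain v where v: "v \<in> L" "v \<notin> (\<Union>b\<in>B. insert b (S b))" by blast
    have "b \<in> S v" if b: "b \<in> B" for b
    proof -
      have "v \<notin> insert b (S b)" using v(2) b by blast
      then show ?thesis using S_total[of b v] b B(1) v(1) by blast
    qed
    then have "B \<subseteq> S v" by blast
    then show False using fin[OF v(1)] B(3) finite_subset by blast
  qed
qed

lemma common_bound:
  assumes "x \<in> L" "y \<in> L"
  shows "\<exists>z\<in>{x, y}. insert x (S x) \<union> insert y (S y) \<subseteq> insert z (S z)"
  using S_total[OF assms] S_mono by blast

text \<open>\<open>J\<close> is generated by the sets of closure points, and \<open>g\<close> glues
  the partitions of the intervals. For the last clause of \<open>separating_base\<close>, an
  operation sends \<open>v\<close> and a label \<open>z\<close> to the point in the class of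
  \<open>z\<close> with the same \<open>F\<close>-value as \<open>v\<close>; a closure point above
  both arguments cannot be such a value.\<close>

lemma separating_base_uncountable:
  assumes "uncountable L"
  shows "\<exists>J g. separating_base L J g"
proof -
  obtain a0 where a0: "a0 \<in> L" "infinite (S a0)" by (rule infinite_segment[OF assms])
  define P where "P W g \<longleftrightarrow> (\<forall>\<phi> d x. (\<forall>v z. finite (\<phi> v z)) \<longrightarrow> d \<in> W \<longrightarrow> x \<in> W \<longrightarrow>
           (\<exists>y\<in>closed_under \<phi> d. V y = W \<and> g y = x))" for W and g :: "'a \<Rightarrow> 'a"
  \<comment> \<open>Chosen from the set \<open>V a\<close> rather than from \<open>a\<close>, so
    that all points of an interval share one function.\<close>
  define G where "G W = (SOME g. P W g)" for W
  have G: "P (V a) (G (V a))" if "a \<in> L" "infinite (S a)" for a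
    unfolding G_def
  proof (rule someI_ex[of "P (V a)"])
    show "\<exists>g. P (V a) g" unfolding P_def by (rule stationary_partition[OF that])
  qed
  define g where "g y = G (V y) y" for y
  define J where "J = {C. C \<subseteq> L \<and> (\<exists>\<phi> d. (\<forall>v z. finite (\<phi> v z)) \<and> d \<in> L \<and> closed_under \<phi> d \<subseteq> C)}"
  have JI: "C \<in> J" if "C \<subseteq> L" "\<And>v z. finite (\<phi> v z)" "d \<in> L" "closed_under \<phi> d \<subseteq> C" for C \<phi> d
    using that unfolding J_def by blast
  have int: "A \<inter> B \<in> J" if AJ: "A \<in> J" and BJ: "B \<in> J" for A B
  proof -
    obtain \<phi> d where A: "\<forall>v z. finite (\<phi> v z)" "d \<in> L" "closed_under \<phi> d \<subseteq> A"
      using AJ unfolding J_def by blast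
    obtain \<psi> d' where B: "\<forall>v z. finite (\<psi> v z)" "d' \<in> L" "closed_under \<psi> d' \<subseteq> B"
      using BJ unfolding J_def by blast
    have AL: "A \<subseteq> L" using AJ unfolding J_def by blast
    obtain c where c: "c \<in> {d, d'}" "insert d (S d) \<union> insert d' (S d') \<subseteq> insert c (S c)"
      using common_bound[OF A(2) B(2)] by blast
    show ?thesis
    proof (rule JI[of _ "\<lambda>v z. \<phi> v z \<union> \<psi> v z" c])
      have "closed_under (\<lambda>v z. \<phi> v z \<union> \<psi> v z) c \<subseteq> closed_under \<phi> d \<inter> closed_under \<psi> d'"
      proof
        fix x assume x: "x \<in> closed_under (\<lambda>v z. \<phi> v z \<union> \<psi> v z) c"
        then have "c \<in> S x" by (simp add: closed_under_def)
        then have "d \<in> S x" "d' \<in> S x" using c(2) S_trans by blast+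
        with x show "x \<in> closed_under \<phi> d \<inter> closed_under \<psi> d'"
          unfolding closed_under_def by auto
      qed
      then show "closed_under (\<lambda>v z. \<phi> v z \<union> \<psi> v z) c \<subseteq> A \<inter> B" using A(3) B(3) by blast
      show "A \<inter> B \<subseteq> L" using AL by blast
      show "finite (\<phi> v z \<union> \<psi> v z)" for v z using A(1) B(1) by simp
      show "c \<in> L" using c(1) A(2) B(2) by blast
    qed
  qed
  have co: "L - {x} \<in> J" if "x \<in> L" for x
    by (rule JI[of _ "\<lambda>_ _. {}" x]) (use that S_irrefl in \<open>auto simp: closed_under_def\<close>)
  have pos: "\<exists>v\<in>C. g v = x" if CJ: "C \<in> J" and x: "x \<in> L" for C x
  proof -
    obtain \<phi> d where *: "\<forall>v z. finite (\<phi> v z)" "d \<in> L" "closed_under \<phi> d \<subseteq> C"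
      using CJ unfolding J_def by blast
    obtain c where c: "c \<in> {d, x}" "insert d (S d) \<union> insert x (S x) \<subseteq> insert c (S c)"
      using common_bound[OF *(2) x] by blast
    have cL: "c \<in> L" using c * x by auto
    \<comment> \<open>Taking \<open>a0\<close> into account makes \<open>S b\<close> infinite, so
      that the partition for \<open>V b\<close> is available.\<close>
    obtain b where b: "b \<in> {c, a0}" "insert c (S c) \<union> insert a0 (S a0) \<subseteq> insert b (S b)"
      using common_bound[OF cL a0(1)] by blast
    have bL: "b \<in> L" using b a0 cL by auto
    have "infinite (S b)" using b(2) a0(2) by (meson finite_insert finite_subset le_sup_iff)
    moreover have "d \<in> V b" "x \<in> V b" using b c V_refl[OF bL] V_S by blast+
    ultimately obtain y where "y \<in> closed_under \<phi> d" "V y = V b" "G (V b) y = x"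
      using G[OF bL] *(1) unfolding P_def by blast
    then show ?thesis using *(3) x by (intro bexI[of _ y]) (auto simp: g_def)
  qed
  have sel: "\<exists>C. (\<forall>z\<in>L. C z \<in> J) \<and> inj_on F {v \<in> L. h (g v) \<in> L \<and> v \<in> C (h (g v))}"
    if inj: "\<forall>z\<in>L. inj_on F {v \<in> L. h (g v) = z}" for h and F :: "'a \<Rightarrow> 'a set"
  proof -
    define \<phi> where "\<phi> v z = {v' \<in> L. z \<in> L \<and> h (g v') = z \<and> F v' = F v}" for v z
    have fin: "finite (\<phi> v z)" for v z
    proof (cases "\<phi> v z = {}")
      case False
      then obtain w where w: "w \<in> \<phi> v z" by blast
      have "\<phi> v z \<subseteq> {w}" using inj w unfolding \<phi>_def inj_on_def by (auto 4 4)
      then show ?thesis using finite_subset by blast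
    qed simp
    \<comment> \<open>\<open>closed_under \<phi> z\<close> lies above \<open>z\<close>, so the label
      \<open>h (g w)\<close> is an admissible argument below \<open>w\<close>; closure then puts
      \<open>w\<close> into its own segment.\<close>
    have key: False if *: "v \<in> S w" "w \<in> closed_under \<phi> (h (g w))" "h (g w) \<in> L" "F v = F w" for v w
    proof -
      have w: "w \<in> L" using *(2) by (simp add: closed_under_def)
      have "w \<in> \<phi> v (h (g w))" using * w by (simp add: \<phi>_def)
      moreover have "w \<in> V w" using V_refl[OF w] .
      ultimately have "w \<in> S w" using *(1,2) unfolding closed_under_def by blast
      then show False using S_irrefl by blast
    qed
    have "inj_on F {v \<in> L. h (g v) \<in> L \<and> v \<in> closed_under \<phi> (h (g v))}"
    proof (rule inj_onI)
      fix v w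
      assume "v \<in> {v \<in> L. h (g v) \<in> L \<and> v \<in> closed_under \<phi> (h (g v))}"
        "w \<in> {v \<in> L. h (g v) \<in> L \<and> v \<in> closed_under \<phi> (h (g v))}" "F v = F w"
      then show "v = w" using key[of v w] key[of w v] S_total[of v w] by auto
    qed
    moreover have "closed_under \<phi> z \<in> J" if "z \<in> L" for z
      by (rule JI[of _ \<phi> z]) (use that fin in \<open>auto simp: closed_under_def\<close>)
    ultimately show ?thesis by (intro exI[of _ "\<lambda>z. closed_under \<phi> z"]) auto
  qed
  have "separating_base L J g"
    unfolding separating_base_def
  proof (intro conjI ballI allI impI)
    show "J \<subseteq> Pow L" by (auto simp: J_def)
  qed (use int co pos sel in blast)+
  then show ?thesis by blast
qed

end

section \<open>The countable case: blocks of factorial size\<close>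

lemma sum_times_fact_le: "(\<Sum>j<k. j * fact j) \<le> (fact k :: nat)"
  by (induction k) auto

text \<open>Blocks of size \<open>k * k!\<close> are preceded by at most \<open>k!\<close> points, so deleting from each block the
  points that conflict with earlier ones removes a negligible part of it.\<close>

lemma separating_base_countable:
  fixes L :: "'a set"
  assumes "countable L" "infinite L"
  shows "\<exists>J g. separating_base L J g"
proof -
  define N where "N = (SIGMA k:UNIV. {..<k * fact k :: nat})"
  \<comment> \<open>Block 0 is empty, hence \<open>Suc k\<close>.\<close>
  have "inj_on (\<lambda>k. (Suc k, 0::nat)) UNIV" "range (\<lambda>k. (Suc k, 0::nat)) \<subseteq> N"
    by (auto simp: N_def inj_on_def)
  then have "infinite N" using finite_imageD finite_subset infinite_UNIV_nat by metis
  moreover have "countable N" by simp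
  ultimately obtain b' where b': "bij_betw b' N (UNIV :: nat set)"
    using countableE_infinite by blast
  obtain \<iota> where \<iota>: "bij_betw \<iota> L (UNIV :: nat set)"
    using countableE_infinite assms by blast
  define \<nu> where "\<nu> = inv_into N b' \<circ> \<iota>"
  have \<nu>: "bij_betw \<nu> L N"
    unfolding \<nu>_def using bij_betw_trans[OF \<iota> bij_betw_inv_into[OF b']] .
  define blk where "blk v = fst (\<nu> v)" for v
  \<comment> \<open>The ignored second component makes \<open>\<pi>\<close> take each value at
    arbitrarily large \<open>k\<close>, as needed to exceed the constant \<open>c\<close> in
    \<open>J\<close>.\<close>
  define \<pi> where "\<pi> k = inv_into L \<iota> (fst (prod_decode k))" for k
  have \<pi>: "\<exists>k>c. \<pi> k = x" if "x \<in> L" for x c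
  proof (intro exI conjI)
    show "c < prod_encode (\<iota> x, Suc c)"
      using le_prod_encode_2[of "Suc c" "\<iota> x"] by linarith
    show "\<pi> (prod_encode (\<iota> x, Suc c)) = x"
      using that \<iota> by (simp add: \<pi>_def bij_betw_inv_into_left)
  qed
  define g where "g v = \<pi> (blk v)" for v
  have card_blk: "card {v \<in> L. blk v = k} = k * fact k" "finite {v \<in> L. blk v = k}" for k
  proof -
    have "\<nu> ` {v \<in> L. blk v = k} = {k} \<times> {..<k * fact k}"
    proof -
      have "\<nu> ` {v \<in> L. blk v = k} = {n \<in> \<nu> ` L. fst n = k}" by (auto simp: blk_def)
      also have "\<dots> = {k} \<times> {..<k * fact k}"
        using \<nu> by (auto simp: bij_betw_def N_def)
      finally show ?thesis .
    qed
    moreover have inj: "inj_on \<nu> {v \<in> L. blk v = k}"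
      using \<nu> by (auto simp: bij_betw_def intro: inj_on_subset)
    ultimately show "card {v \<in> L. blk v = k} = k * fact k" "finite {v \<in> L. blk v = k}"
      using card_image[OF inj] finite_imageD[OF _ inj] by (simp_all add: card_cartesian_product)
  qed
  have card_prior: "card {v \<in> L. blk v < k} \<le> fact k" "finite {v \<in> L. blk v < k}" for k
  proof -
    have eq: "{v \<in> L. blk v < k} = (\<Union>j<k. {v \<in> L. blk v = j})" by auto
    show "finite {v \<in> L. blk v < k}" unfolding eq using card_blk by auto
    have "card {v \<in> L. blk v < k} \<le> (\<Sum>j<k. j * fact j)"
      unfolding eq using card_UN_le[of "{..<k}" "\<lambda>j. {v \<in> L. blk v = j}"] card_blk(1) by simp
    then show "card {v \<in> L. blk v < k} \<le> fact k" using sum_times_fact_le[of k] by linarith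
  qed
  \<comment> \<open>Since block \<open>k\<close> has \<open>k * fact k\<close> points, a set in
    \<open>J\<close> with constant \<open>c\<close> meets every block with
    \<open>k > c\<close>.\<close>
  define J where "J = {C. C \<subseteq> L \<and> (\<exists>c. \<forall>k. card {v \<in> L - C. blk v = k} \<le> c * fact k)}"
  have int: "A \<inter> B \<in> J" if AJ: "A \<in> J" and BJ: "B \<in> J" for A B
  proof -
    obtain c where c: "\<And>k. card {v \<in> L - A. blk v = k} \<le> c * fact k"
      using AJ unfolding J_def by blast
    obtain d where d: "\<And>k. card {v \<in> L - B. blk v = k} \<le> d * fact k"
      using BJ unfolding J_def by blast
    have "card {v \<in> L - A \<inter> B. blk v = k} \<le> (c + d) * fact k" for k
    proof -
      have "{v \<in> L - A \<inter> B. blk v = k} = {v \<in> L - A. blk v = k} \<union> {v \<in> L - B. blk v = k}" by auto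
      then have "card {v \<in> L - A \<inter> B. blk v = k} \<le>
          card {v \<in> L - A. blk v = k} + card {v \<in> L - B. blk v = k}"
        by (simp add: card_Un_le)
      then show ?thesis using c[of k] d[of k] by (simp add: algebra_simps)
    qed
    moreover have "A \<inter> B \<subseteq> L" using AJ unfolding J_def by blast
    ultimately show ?thesis unfolding J_def by blast
  qed
  have co: "L - {x} \<in> J" if "x \<in> L" for x
  proof -
    have "card {v \<in> L - (L - {x}). blk v = k} \<le> 1 * fact k" for k
    proof -
      have "card {v \<in> L - (L - {x}). blk v = k} \<le> card {x}" by (intro card_mono) auto
      also have "\<dots> \<le> fact k" by (simp add: Suc_leI)
      finally show ?thesis by simp
    qed
    then show ?thesis unfolding J_def by blast
  qed
  have pos: "\<exists>v\<in>C. g v = x" if CJ: "C \<in> J" and x: "x \<in> L" for C x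
  proof -
    obtain c where c: "\<And>k. card {v \<in> L - C. blk v = k} \<le> c * fact k"
      using CJ unfolding J_def by blast
    obtain k where k: "k > c" "\<pi> k = x" using \<pi>[OF x] by blast
    have "c * fact k < k * fact k" using k(1) by (intro mult_strict_right_mono) auto
    then have "{v \<in> L - C. blk v = k} \<noteq> {v \<in> L. blk v = k}"
      using c[of k] card_blk(1)[of k] by force
    then obtain v where "v \<in> C" "blk v = k" by blast
    then show ?thesis using k(2) unfolding g_def by blast
  qed
  have sel: "\<exists>C. (\<forall>z\<in>L. C z \<in> J) \<and> inj_on F {v \<in> L. h (g v) \<in> L \<and> v \<in> C (h (g v))}"
    if inj: "\<forall>z\<in>L. inj_on F {v \<in> L. h (g v) = z}" for h and F :: "'a \<Rightarrow> 'a set"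
  proof -
    \<comment> \<open>One \<open>C\<close> serves all labels: within a block \<open>g\<close> is
      constant, so conflicts there are excluded by the hypothesis on \<open>F\<close>.\<close>
    define C where "C = {v \<in> L. h (g v) \<in> L \<longrightarrow> (\<forall>w\<in>L. blk w < blk v \<longrightarrow> F w \<noteq> F v)}"
    have "card {v \<in> L - C. blk v = k} \<le> 1 * fact k" for k
    proof (cases "h (\<pi> k) \<in> L")
      case False
      then have "{v \<in> L - C. blk v = k} = {}" by (auto simp: C_def g_def)
      then show ?thesis by (metis card.empty le0)
    next
      case True
      then have injk: "inj_on F {v \<in> L. blk v = k}"
        using inj by (auto simp: g_def inj_on_def)
      have "card {v \<in> L - C. blk v = k} = card (F ` {v \<in> L - C. blk v = k})"
        using card_image[OF inj_on_subset[OF injk]] by (metis (mono_tags, lifting) Collect_mono Diff_iff)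
      also have "\<dots> \<le> card (F ` {v \<in> L. blk v < k})"
        using card_prior(2) by (intro card_mono) (auto simp: C_def)
      also have "\<dots> \<le> card {v \<in> L. blk v < k}"
        using card_prior(2) by (rule card_image_le)
      also have "\<dots> \<le> fact k" by (rule card_prior)
      finally show ?thesis by simp
    qed
    then have "C \<in> J" unfolding J_def C_def by blast
    moreover have "inj_on F {v \<in> L. h (g v) \<in> L \<and> v \<in> C}"
    proof (rule inj_onI)
      fix v w
      assume *: "v \<in> {v \<in> L. h (g v) \<in> L \<and> v \<in> C}" "w \<in> {v \<in> L. h (g v) \<in> L \<and> v \<in> C}" "F v = F w"
      then have "\<not> blk v < blk w" "\<not> blk w < blk v" by (auto simp: C_def)
      then have "g v = g w" by (simp add: g_def)
      then show "v = w" using * inj by (auto simp: inj_on_def)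
    qed
    ultimately show ?thesis by (intro exI[of _ "\<lambda>_. C"]) auto
  qed
  have "separating_base L J g"
    unfolding separating_base_def
  proof (intro conjI ballI allI impI)
    show "J \<subseteq> Pow L" by (auto simp: J_def)
  qed (use int co pos sel in blast)+
  then show ?thesis by blast
qed

lemma separating_base_exists:
  fixes L :: "'a set"
  assumes "infinite L"
  shows "\<exists>J g. separating_base L J g"
proof (cases "countable L")
  case True
  then show ?thesis using separating_base_countable assms by blast
next
  case False
  obtain S where "card_segments L S" using card_segments_exists[OF assms] by blast
  then show ?thesis using card_segments.separating_base_uncountable False by blast
qed

subsection \<open>Ultrafilters with disjoint images\<close>

text \<open>Hausdorff's construction of an independent family: a point of \<open>L\<close> codes a finite set \<open>w\<close>
  together with finitely many prescriptions of values at traces on \<open>w\<close>.\<close>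

lemma independent_functions:
  fixes L :: "'a set"
  assumes "infinite L"
  shows "\<exists>h :: 'a set \<Rightarrow> 'a \<Rightarrow> 'a. \<forall>I v. I \<subseteq> Pow L \<longrightarrow> finite I \<longrightarrow> v ` I \<subseteq> L \<longrightarrow>
           (\<exists>q\<in>L. \<forall>i\<in>I. h i q = v i)"
proof -
  define Q where "Q = Fpow L \<times> Fpow (Fpow L \<times> L)"
  have FL: "|Fpow L \<times> L| \<le>o |L|"
    using assms card_of_Times_ordLeq_infinite card_of_Fpow_ordLeq card_ordLeq_refl by blast
  have "infinite (Fpow L \<times> L)"
    using assms empty_in_Fpow[of L] by (auto simp: finite_cartesian_product_iff)
  then have "|Q| \<le>o |L|"
    unfolding Q_def using assms FL card_of_Fpow_ordLeq ordLeq_transitive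
    by (metis card_of_Times_ordLeq_infinite)
  then obtain q where q: "inj_on q Q" "q ` Q \<subseteq> L" using card_of_ordLeq[of Q L] by blast
  define h where "h i x = (SOME y. (i \<inter> fst (inv_into Q q x), y) \<in> snd (inv_into Q q x))" for i x
  show ?thesis
  proof (intro exI[of _ h] allI impI)
    fix I and v :: "'a set \<Rightarrow> 'a" assume I: "I \<subseteq> Pow L" "finite I" "v ` I \<subseteq> L"
    have "\<forall>i j. \<exists>x. i \<in> I \<longrightarrow> j \<in> I \<longrightarrow> i \<noteq> j \<longrightarrow> x \<in> L \<and> (x \<in> i \<longleftrightarrow> x \<notin> j)"
      using I(1) by blast
    then obtain s where s: "\<And>i j. i \<in> I \<Longrightarrow> j \<in> I \<Longrightarrow> i \<noteq> j \<Longrightarrow>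
        s i j \<in> L \<and> (s i j \<in> i \<longleftrightarrow> s i j \<notin> j)" by metis
    \<comment> \<open>The intersection with \<open>L\<close> discards the unspecified values
      \<open>s i i\<close>.\<close>
    define w where "w = (\<lambda>(i, j). s i j) ` (I \<times> I) \<inter> L"
    have w: "w \<in> Fpow L" using I(2) by (auto simp: w_def Fpow_def)
    have sep: "i = j" if "i \<in> I" "j \<in> I" "i \<inter> w = j \<inter> w" for i j
    proof (rule ccontr)
      assume "i \<noteq> j"
      then have "s i j \<in> w" "s i j \<in> i \<longleftrightarrow> s i j \<notin> j"
        using s[of i j] that by (auto simp: w_def)
      then show False using that(3) by blast
    qed
    define \<Phi> where "\<Phi> = (\<lambda>i. (i \<inter> w, v i)) ` I"
    have "\<Phi> \<in> Fpow (Fpow L \<times> L)"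
      using I w by (auto simp: \<Phi>_def Fpow_def)
    with w have Q: "(w, \<Phi>) \<in> Q" by (simp add: Q_def)
    show "\<exists>x\<in>L. \<forall>i\<in>I. h i x = v i"
    proof (intro bexI[of _ "q (w, \<Phi>)"] ballI)
      show "q (w, \<Phi>) \<in> L" using q(2) Q by blast
      fix i assume i: "i \<in> I"
      have "(SOME y. (i \<inter> w, y) \<in> \<Phi>) = v i"
      proof (rule some_equality)
        show "(i \<inter> w, v i) \<in> \<Phi>" using i by (auto simp: \<Phi>_def)
        show "y = v i" if "(i \<inter> w, y) \<in> \<Phi>" for y
          using that sep[OF i] by (auto simp: \<Phi>_def)
      qed
      then show "h i (q (w, \<Phi>)) = v i"
        by (simp add: h_def inv_into_f_f[OF q(1) Q])
    qed
  qed
qed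

text \<open>An index \<open>i\<close> codes sets \<open>u \<xi>\<close> (tag 0), the traces on the \<open>u \<xi>\<close> of the families to be
  labelled (tag 1) and the labels in use (tag 2); the tag 3 merely enumerates pairs of labels.\<close>

lemma simultaneous_labels:
  fixes L :: "'a set"
  assumes "infinite L"
  shows "\<exists>e :: 'a set set \<Rightarrow> 'a set \<Rightarrow> 'a. (\<forall>\<alpha> i. e \<alpha> i \<in> L) \<and>
           (\<forall>D z. D \<subseteq> Pow (Pow L) \<longrightarrow> inj_on z D \<longrightarrow> z ` D \<subseteq> L \<longrightarrow>
              (\<exists>i\<in>Pow L. \<forall>\<alpha>\<in>D. e \<alpha> i = z \<alpha>))"
proof -
  define T where "T = (UNIV :: nat set) \<times> L \<times> L"
  have "|UNIV :: nat set| \<le>o |L|" using assms infinite_iff_card_of_nat by blast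
  then have "|T| \<le>o |L|"
    unfolding T_def using assms card_of_Times_ordLeq_infinite card_ordLeq_refl by metis
  then obtain \<tau> where \<tau>: "inj_on \<tau> T" "\<tau> ` T \<subseteq> L" using card_of_ordLeq[of T L] by blast
  have \<tau>L: "\<tau> (n, x, y) \<in> L" if "x \<in> L" "y \<in> L" for n x y
    using that \<tau>(2) by (auto simp: T_def)
  have \<tau>eq: "\<tau> (n, x, y) = \<tau> (n', x', y') \<longleftrightarrow> n = n' \<and> x = x' \<and> y = y'"
    if "x \<in> L" "y \<in> L" "x' \<in> L" "y' \<in> L" for n n' x y x' y'
    using that inj_on_eq_iff[OF \<tau>(1), of "(n, x, y)" "(n', x', y')"] by (auto simp: T_def)
  obtain x0 where x0: "x0 \<in> L" using infinite_imp_nonempty[OF assms] by blast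
  define u where "u i \<xi> = {x \<in> L. \<tau> (0, \<xi>, x) \<in> i}" for i \<xi>
  define s where "s \<alpha> i = (SOME \<zeta>. \<zeta> \<in> L \<and> \<tau> (2, \<zeta>, \<zeta>) \<in> i \<and>
      {\<xi> \<in> L. \<tau> (1, \<zeta>, \<xi>) \<in> i} = {\<xi> \<in> L. u i \<xi> \<in> \<alpha>})" for \<alpha> i
  \<comment> \<open>The fallback keeps \<open>e\<close> inside \<open>L\<close> when no suitable
    label exists.\<close>
  define e where "e \<alpha> i = (if s \<alpha> i \<in> L then s \<alpha> i else x0)" for \<alpha> i
  show ?thesis
  proof (intro exI[of _ e] conjI allI impI)
    show "e \<alpha> i \<in> L" for \<alpha> i using x0 by (simp add: e_def)
    fix D and z :: "'a set set \<Rightarrow> 'a"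
    assume D: "D \<subseteq> Pow (Pow L)" and z: "inj_on z D" "z ` D \<subseteq> L"
    have "\<exists>A. A \<subseteq> L \<and> (\<alpha> \<in> D \<longrightarrow> \<beta> \<in> D \<longrightarrow> \<alpha> \<noteq> \<beta> \<longrightarrow> (A \<in> \<alpha> \<longleftrightarrow> A \<notin> \<beta>))" for \<alpha> \<beta>
    proof (cases "\<alpha> \<in> D \<and> \<beta> \<in> D \<and> \<alpha> \<noteq> \<beta>")
      case True
      then obtain A where A: "A \<in> \<alpha> \<longleftrightarrow> A \<notin> \<beta>" by (metis set_eqI)
      moreover have "\<alpha> \<subseteq> Pow L" "\<beta> \<subseteq> Pow L" using True D by auto
      ultimately have "A \<subseteq> L" by (cases "A \<in> \<alpha>") auto
      with A show ?thesis by (intro exI[of _ A]) simp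
    qed auto
    then obtain S where S: "\<And>\<alpha> \<beta>. S \<alpha> \<beta> \<subseteq> L"
      "\<And>\<alpha> \<beta>. \<alpha> \<in> D \<Longrightarrow> \<beta> \<in> D \<Longrightarrow> \<alpha> \<noteq> \<beta> \<Longrightarrow> S \<alpha> \<beta> \<in> \<alpha> \<longleftrightarrow> S \<alpha> \<beta> \<notin> \<beta>"
      by metis
    \<comment> \<open>The tag 3 code of two labels is mapped to a set separating the labelled
      families, so distinct members of \<open>D\<close> have distinct traces.\<close>
    define u' where "u' \<xi> = (let (n, a, b) = inv_into T \<tau> \<xi> in S (inv_into D z a) (inv_into D z b))" for \<xi>
    have u'S: "u' (\<tau> (3, z \<alpha>, z \<beta>)) = S \<alpha> \<beta>" if "\<alpha> \<in> D" "\<beta> \<in> D" for \<alpha> \<beta>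
      using that z \<tau>(1) inv_into_f_f[OF \<tau>(1), of "(3, z \<alpha>, z \<beta>)"]
      by (auto simp: u'_def T_def image_subset_iff)
    have u'L: "u' \<xi> \<subseteq> L" for \<xi> using S(1) by (simp add: u'_def split: prod.split)
    have zL: "z \<alpha> \<in> L" if "\<alpha> \<in> D" for \<alpha> using z that by blast
    define i where "i = {\<tau> (0, \<xi>, x) | \<xi> x. \<xi> \<in> L \<and> x \<in> u' \<xi>} \<union>
        {\<tau> (1, z \<alpha>, \<xi>) | \<alpha> \<xi>. \<alpha> \<in> D \<and> \<xi> \<in> L \<and> u' \<xi> \<in> \<alpha>} \<union> {\<tau> (2, z \<alpha>, z \<alpha>) | \<alpha>. \<alpha> \<in> D}"
    have i0: "\<tau> (0, \<xi>, x) \<in> i \<longleftrightarrow> x \<in> u' \<xi>" if in_L: "\<xi> \<in> L" "x \<in> L" for \<xi> x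
    proof
      assume "\<tau> (0, \<xi>, x) \<in> i"
      then obtain \<xi>' x' where "\<tau> (0, \<xi>, x) = \<tau> (0, \<xi>', x')" "\<xi>' \<in> L" "x' \<in> u' \<xi>'"
        unfolding i_def using in_L zL by (auto simp: \<tau>eq)
      then show "x \<in> u' \<xi>" using \<tau>eq[of \<xi> x \<xi>' x'] in_L u'L by blast
    qed (use in_L in \<open>auto simp: i_def\<close>)
    have i1: "\<tau> (1, z \<alpha>, \<xi>) \<in> i \<longleftrightarrow> u' \<xi> \<in> \<alpha>" if in_D: "\<alpha> \<in> D" "\<xi> \<in> L" for \<alpha> \<xi>
    proof
      assume "\<tau> (1, z \<alpha>, \<xi>) \<in> i"
      then obtain \<beta> \<xi>' where "\<tau> (1, z \<alpha>, \<xi>) = \<tau> (1, z \<beta>, \<xi>')" "\<beta> \<in> D" "\<xi>' \<in> L" "u' \<xi>' \<in> \<beta>"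
        unfolding i_def using in_D zL subsetD[OF u'L] by (auto simp: \<tau>eq)
      moreover from this have "z \<alpha> = z \<beta>" "\<xi> = \<xi>'"
        using \<tau>eq[of "z \<alpha>" \<xi> "z \<beta>" \<xi>'] in_D zL by blast+
      ultimately show "u' \<xi> \<in> \<alpha>" using inj_onD[OF z(1)] in_D(1) by blast
    qed (use in_D in \<open>auto simp: i_def\<close>)
    have i2: "\<tau> (2, \<zeta>, \<zeta>) \<in> i \<longleftrightarrow> \<zeta> \<in> z ` D" if in_L: "\<zeta> \<in> L" for \<zeta>
    proof
      assume "\<tau> (2, \<zeta>, \<zeta>) \<in> i"
      then obtain \<alpha> where "\<tau> (2, \<zeta>, \<zeta>) = \<tau> (2, z \<alpha>, z \<alpha>)" "\<alpha> \<in> D"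
        unfolding i_def using in_L zL subsetD[OF u'L] by (auto simp: \<tau>eq)
      then show "\<zeta> \<in> z ` D" using \<tau>eq[of \<zeta> \<zeta> "z \<alpha>" "z \<alpha>"] in_L zL by blast
    qed (auto simp: i_def)
    have ui: "u i \<xi> = u' \<xi>" if "\<xi> \<in> L" for \<xi>
      using i0[OF that] u'L by (auto simp: u_def)
    have "s \<alpha> i = z \<alpha>" if \<alpha>: "\<alpha> \<in> D" for \<alpha>
      unfolding s_def
    proof (rule some_equality)
      show "z \<alpha> \<in> L \<and> \<tau> (2, z \<alpha>, z \<alpha>) \<in> i \<and> {\<xi> \<in> L. \<tau> (1, z \<alpha>, \<xi>) \<in> i} = {\<xi> \<in> L. u i \<xi> \<in> \<alpha>}"
        using zL \<alpha> i1 i2 ui by auto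
      fix \<zeta>
      assume *: "\<zeta> \<in> L \<and> \<tau> (2, \<zeta>, \<zeta>) \<in> i \<and> {\<xi> \<in> L. \<tau> (1, \<zeta>, \<xi>) \<in> i} = {\<xi> \<in> L. u i \<xi> \<in> \<alpha>}"
      then obtain \<beta> where \<beta>: "\<beta> \<in> D" "\<zeta> = z \<beta>" using i2 by blast
      have "\<alpha> = \<beta>"
      proof (rule ccontr)
        assume ne: "\<alpha> \<noteq> \<beta>"
        define \<xi> where "\<xi> = \<tau> (3, z \<alpha>, z \<beta>)"
        have \<xi>: "\<xi> \<in> L" using \<tau>L zL \<alpha> \<beta> by (simp add: \<xi>_def)
        have "\<xi> \<in> {\<xi> \<in> L. \<tau> (1, \<zeta>, \<xi>) \<in> i} \<longleftrightarrow> \<xi> \<in> {\<xi> \<in> L. u i \<xi> \<in> \<alpha>}"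
          using * by (simp only:)
        then have "u' \<xi> \<in> \<beta> \<longleftrightarrow> u' \<xi> \<in> \<alpha>"
          using \<xi> i1[OF \<beta>(1) \<xi>] ui[OF \<xi>] unfolding \<beta>(2) mem_Collect_eq by simp
        moreover have "u' \<xi> = S \<alpha> \<beta>" using u'S \<alpha> \<beta> by (simp add: \<xi>_def)
        ultimately show False using S(2)[OF \<alpha> \<beta>(1) ne] by simp
      qed
      with \<beta> show "\<zeta> = z \<alpha>" by simp
    qed
    then have "\<forall>\<alpha>\<in>D. e \<alpha> i = z \<alpha>" using zL by (simp add: e_def)
    moreover have "i \<in> Pow L" using \<tau>L zL subsetD[OF u'L] by (auto simp: i_def)
    ultimately show "\<exists>i\<in>Pow L. \<forall>\<alpha>\<in>D. e \<alpha> i = z \<alpha>" by blast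
  qed
qed

text \<open>Upward closure follows from these clauses, see
  \<open>ultrafilter_on_mono\<close>.\<close>

definition ultrafilter_on :: "'a set \<Rightarrow> 'a set set \<Rightarrow> bool" where
  "ultrafilter_on L U \<longleftrightarrow> U \<subseteq> Pow L \<and> {} \<notin> U \<and> (\<forall>A\<in>U. \<forall>B\<in>U. A \<inter> B \<in> U) \<and>
     (\<forall>A. A \<subseteq> L \<longrightarrow> A \<in> U \<or> L - A \<in> U)"

lemma ultrafilter_on_mono:
  assumes U: "ultrafilter_on L U" and "A \<in> U" "A \<subseteq> B" "B \<subseteq> L"
  shows "B \<in> U"
proof (rule ccontr)
  assume "B \<notin> U"
  then have "A \<inter> (L - B) \<in> U" using assms unfolding ultrafilter_on_def by blast
  moreover have "A \<inter> (L - B) = {}" using assms by blast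
  ultimately show False using U unfolding ultrafilter_on_def by simp
qed

lemma ultrafilter_on_Diff_iff:
  assumes "ultrafilter_on L U" "A \<subseteq> L"
  shows "L - A \<in> U \<longleftrightarrow> A \<notin> U"
proof -
  have "A \<inter> (L - A) = {}" by blast
  then show ?thesis using assms unfolding ultrafilter_on_def by metis
qed

lemma ultrafilter_on_Int_iff:
  assumes "ultrafilter_on L U" "A \<subseteq> L" "B \<subseteq> L"
  shows "A \<inter> B \<in> U \<longleftrightarrow> A \<in> U \<and> B \<in> U"
  using assms ultrafilter_on_mono[OF assms(1), of "A \<inter> B"] unfolding ultrafilter_on_def by blast

text \<open>A family maximal with the finite intersection property, given by Zorn's lemma, is an
  ultrafilter. For empty \<open>F\<close> the hypothesis says that \<open>L\<close> is
  nonempty.\<close>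

lemma ultrafilter_on_exists:
  assumes G: "G \<subseteq> Pow L" and fip: "\<And>F. finite F \<Longrightarrow> F \<subseteq> G \<Longrightarrow> L \<inter> \<Inter>F \<noteq> {}"
  shows "\<exists>U. ultrafilter_on L U \<and> G \<subseteq> U"
proof -
  define X where "X = {M. G \<subseteq> M \<and> M \<subseteq> Pow L \<and> (\<forall>F. finite F \<longrightarrow> F \<subseteq> M \<longrightarrow> L \<inter> \<Inter>F \<noteq> {})}"
  have "\<exists>M\<in>X. \<forall>N\<in>X. M \<subseteq> N \<longrightarrow> N = M"
  proof (rule subset_Zorn_nonempty)
    show "X \<noteq> {}" using assms unfolding X_def by blast
    fix \<C> assume C: "\<C> \<noteq> {}" "subset.chain X \<C>"
    have "L \<inter> \<Inter>F \<noteq> {}" if F: "finite F" "F \<subseteq> \<Union>\<C>" for F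
    proof -
      obtain M where "M \<in> \<C>" "F \<subseteq> M"
        using finite_subset_Union_chain[OF F C] by blast
      moreover from this have "M \<in> X" using C(2) unfolding subset.chain_def by blast
      ultimately show ?thesis using F(1) unfolding X_def by blast
    qed
    moreover have *: "G \<subseteq> N \<and> N \<subseteq> Pow L" if N: "N \<in> \<C>" for N
    proof -
      have "N \<in> X" using C(2) N unfolding subset.chain_def by blast
      then show ?thesis by (simp add: X_def)
    qed
    moreover have "G \<subseteq> \<Union>\<C>"
    proof -
      obtain N where "N \<in> \<C>" using C(1) by blast
      with * show ?thesis by blast
    qed
    moreover have "\<Union>\<C> \<subseteq> Pow L" using * by (simp add: Union_least)
    ultimately have "G \<subseteq> \<Union>\<C> \<and> \<Union>\<C> \<subseteq> Pow L \<and> (\<forall>F. finite F \<longrightarrow> F \<subseteq> \<Union>\<C> \<longrightarrow> L \<inter> \<Inter>F \<noteq> {})"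
      by simp
    then show "\<Union>\<C> \<in> X" unfolding X_def by simp
  qed
  then obtain M where M: "M \<in> X" and max: "\<And>N. N \<in> X \<Longrightarrow> M \<subseteq> N \<Longrightarrow> N = M" by blast
  have M': "G \<subseteq> M \<and> M \<subseteq> Pow L \<and> (\<forall>F. finite F \<longrightarrow> F \<subseteq> M \<longrightarrow> L \<inter> \<Inter>F \<noteq> {})"
    using M unfolding X_def by (rule CollectD)
  then have GM: "G \<subseteq> M" and subM: "M \<subseteq> Pow L"
    and fipM: "\<And>F. finite F \<Longrightarrow> F \<subseteq> M \<Longrightarrow> L \<inter> \<Inter>F \<noteq> {}"
    by simp_all
  have add: "A \<in> M" if A: "A \<subseteq> L" and *: "\<And>F. finite F \<Longrightarrow> F \<subseteq> M \<Longrightarrow> L \<inter> \<Inter>F \<inter> A \<noteq> {}" for A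
  proof -
    have "L \<inter> \<Inter>F \<noteq> {}" if F: "finite F" "F \<subseteq> insert A M" for F
    proof -
      have "L \<inter> \<Inter>(F - {A}) \<inter> A \<noteq> {}"
      proof (rule *)
        show "finite (F - {A})" using F(1) by simp
        show "F - {A} \<subseteq> M" using F(2) by auto
      qed
      moreover have "L \<inter> \<Inter>(F - {A}) \<inter> A \<subseteq> L \<inter> \<Inter>F" by auto
      ultimately show ?thesis by blast
    qed
    then have "insert A M \<in> X" using A GM subM by (auto simp: X_def)
    then have "insert A M = M" by (rule max) auto
    then show ?thesis by blast
  qed
  have "ultrafilter_on L M"
    unfolding ultrafilter_on_def
  proof (intro conjI ballI allI impI)
    show "M \<subseteq> Pow L" by (rule subM)
    show "{} \<notin> M" using fipM[of "{{}}"] by auto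
    show "A \<inter> B \<in> M" if AB: "A \<in> M" "B \<in> M" for A B
    proof (rule add)
      show "A \<inter> B \<subseteq> L" using AB subM by blast
      show "L \<inter> \<Inter>F \<inter> (A \<inter> B) \<noteq> {}" if "finite F" "F \<subseteq> M" for F
        using fipM[of "F \<union> {A, B}"] that AB by (simp add: Int_ac)
    qed
    show "A \<in> M \<or> L - A \<in> M" if A: "A \<subseteq> L" for A
    proof (cases "A \<in> M")
      case False
      then obtain F where F: "finite F" "F \<subseteq> M" "L \<inter> \<Inter>F \<inter> A = {}" using add[OF A] by metis
      have "L - A \<in> M"
      proof (rule add)
        show "L \<inter> \<Inter>F' \<inter> (L - A) \<noteq> {}" if "finite F'" "F' \<subseteq> M" for F'
        proof -
          have "L \<inter> \<Inter>(F \<union> F') \<noteq> {}" using fipM[of "F \<union> F'"] that F by blast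
          then show ?thesis using F(3) by blast
        qed
      qed blast
      then show ?thesis by simp
    qed simp
  qed
  then show ?thesis using GM by blast
qed

text \<open>\<open>p \<alpha>\<close> prescribes the value \<open>e \<alpha> i\<close> of
  \<open>h i\<close> after \<open>g\<close> for every index \<open>i\<close>. Given
  \<open>D\<close>, one index gives its members distinct labels, so the regions
  \<open>R \<alpha> i\<close> are disjoint and the families \<open>f \<alpha>\<close> glue to one
  function on \<open>L\<close>. The last clause of \<open>separating_base\<close> then removes the
  conflicts between regions.\<close>

lemma disjointing_ultrafilters:
  fixes L :: "'a set"
  assumes "infinite L"
  shows "\<exists>p :: 'a set set \<Rightarrow> 'a set set.
     (\<forall>\<alpha>\<in>Pow (Pow L). ultrafilter_on L (p \<alpha>) \<and> (\<forall>x\<in>L. L - {x} \<in> p \<alpha>)) \<and>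
     (\<forall>D (f :: 'a set set \<Rightarrow> 'a \<Rightarrow> 'b). D \<subseteq> Pow (Pow L) \<longrightarrow> |D| \<le>o |L| \<longrightarrow> (\<forall>\<alpha>\<in>D. inj_on (f \<alpha>) L) \<longrightarrow>
        (\<exists>E. (\<forall>\<alpha>\<in>D. E \<alpha> \<in> p \<alpha>) \<and>
             (\<forall>\<alpha>\<in>D. \<forall>\<beta>\<in>D. \<forall>v\<in>E \<alpha>. \<forall>w\<in>E \<beta>. f \<alpha> v = f \<beta> w \<longrightarrow> \<alpha> = \<beta>)))"
proof -
  obtain J g where sb: "separating_base L J g" using separating_base_exists[OF assms] by blast
  have JL: "J \<subseteq> Pow L" and Jint: "\<forall>A\<in>J. \<forall>B\<in>J. A \<inter> B \<in> J"
    and Jco: "\<forall>x\<in>L. L - {x} \<in> J"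
    and Jpos: "\<forall>C\<in>J. \<forall>x\<in>L. \<exists>v\<in>C. g v = x"
    and Jsel: "\<forall>h. \<forall>F :: 'a \<Rightarrow> 'a set. (\<forall>z\<in>L. inj_on F {v \<in> L. h (g v) = z}) \<longrightarrow>
        (\<exists>C. (\<forall>z\<in>L. C z \<in> J) \<and> inj_on F {v \<in> L. h (g v) \<in> L \<and> v \<in> C (h (g v))})"
    using sb unfolding separating_base_def by - (elim conjE, assumption)+
  obtain h where h: "\<And>I v. I \<subseteq> Pow L \<Longrightarrow> finite I \<Longrightarrow> v ` I \<subseteq> L \<Longrightarrow> \<exists>q\<in>L. \<forall>i\<in>I. h i q = v i"
    using independent_functions[OF assms] by blast
  obtain e where eL: "\<And>\<alpha> i. e \<alpha> i \<in> L"
    and e: "\<And>D z. D \<subseteq> Pow (Pow L) \<Longrightarrow> inj_on z D \<Longrightarrow> z ` D \<subseteq> L \<Longrightarrow> \<exists>i\<in>Pow L. \<forall>\<alpha>\<in>D. e \<alpha> i = z \<alpha>"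
    using simultaneous_labels[OF assms] by blast
  obtain x0 where x0: "x0 \<in> L" using infinite_imp_nonempty[OF assms] by blast
  define R where "R \<alpha> i = {v \<in> L. h i (g v) = e \<alpha> i}" for \<alpha> i
  \<comment> \<open>Finitely many prescriptions are met at a single \<open>q\<close> by
    independence, and the piece where \<open>g v = q\<close> meets every set in
    \<open>J\<close>.\<close>
  have "\<exists>U. ultrafilter_on L U \<and> J \<union> R \<alpha> ` Pow L \<subseteq> U" for \<alpha>
  proof (rule ultrafilter_on_exists)
    show "J \<union> R \<alpha> ` Pow L \<subseteq> Pow L" using JL by (auto simp: R_def)
    fix F assume F: "finite F" "F \<subseteq> J \<union> R \<alpha> ` Pow L"
    have inter: "\<exists>C\<in>J. C \<subseteq> \<Inter>F1" if "finite F1" "F1 \<subseteq> J" for F1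
      using that
    proof (induction F1)
      case empty
      then show ?case using Jco x0 by blast
    next
      case (insert A F1)
      then obtain C where "C \<in> J" "C \<subseteq> \<Inter>F1" by blast
      then show ?case using insert.prems Jint by (intro bexI[of _ "A \<inter> C"]) auto
    qed
    obtain C where C: "C \<in> J" "C \<subseteq> \<Inter>(F \<inter> J)" using inter[of "F \<inter> J"] F by blast
    obtain I where I: "I \<subseteq> Pow L" "finite I" "F - J = R \<alpha> ` I"
    proof -
      have "finite (F - J)" "F - J \<subseteq> R \<alpha> ` Pow L" using F by auto
      from finite_subset_image[OF this] show ?thesis using that by (elim exE conjE)
    qed
    obtain q where q: "q \<in> L" "\<forall>i\<in>I. h i q = e \<alpha> i" using h[OF I(1,2), of "e \<alpha>"] eL by blast
    obtain v where v: "v \<in> C" "g v = q" using Jpos C(1) q(1) by blast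
    have vL: "v \<in> L" using v(1) C(1) JL by blast
    have "v \<in> A" if A: "A \<in> F" for A
    proof (cases "A \<in> J")
      case True
      then have "A \<in> F \<inter> J" using A by simp
      then show ?thesis using C(2) v(1) by (meson InterD subsetD)
    next
      case False
      then have "A \<in> R \<alpha> ` I" using A I(3) by blast
      then obtain i where "i \<in> I" "A = R \<alpha> i" by (rule imageE)
      then show ?thesis using q(2) v(2) vL by (simp add: R_def)
    qed
    then have "v \<in> L \<inter> \<Inter>F" using vL by simp
    then show "L \<inter> \<Inter>F \<noteq> {}" by (metis empty_iff)
  qed
  then obtain p where p: "\<And>\<alpha>. ultrafilter_on L (p \<alpha>)" "\<And>\<alpha>. J \<union> R \<alpha> ` Pow L \<subseteq> p \<alpha>" by metis
  show ?thesis
  proof (intro exI[of _ p] conjI ballI allI impI)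
    show "ultrafilter_on L (p \<alpha>)" for \<alpha> by (rule p)
    show "L - {x} \<in> p \<alpha>" if "x \<in> L" for x \<alpha> using Jco that p(2) by blast
    fix D and f :: "'a set set \<Rightarrow> 'a \<Rightarrow> 'b"
    assume D: "D \<subseteq> Pow (Pow L)" "|D| \<le>o |L|" and f: "\<forall>\<alpha>\<in>D. inj_on (f \<alpha>) L"
    show "\<exists>E. (\<forall>\<alpha>\<in>D. E \<alpha> \<in> p \<alpha>) \<and>
             (\<forall>\<alpha>\<in>D. \<forall>\<beta>\<in>D. \<forall>v\<in>E \<alpha>. \<forall>w\<in>E \<beta>. f \<alpha> v = f \<beta> w \<longrightarrow> \<alpha> = \<beta>)"
    proof (cases "D = {}")
      case False
      then obtain d where d: "d \<in> D" by blast
      obtain z where z: "inj_on z D" "z ` D \<subseteq> L" using D(2) card_of_ordLeq[of D L] by blast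
      obtain i where i: "i \<in> Pow L" "\<forall>\<alpha>\<in>D. e \<alpha> i = z \<alpha>" using e[OF D(1) z] by blast
      \<comment> \<open>The default \<open>d\<close> makes \<open>fr\<close> injective also on the
        classes of labels that no member of \<open>D\<close> carries.\<close>
      define \<delta> where "\<delta> \<zeta> = (if \<zeta> \<in> z ` D then inv_into D z \<zeta> else d)" for \<zeta>
      have \<delta>D: "\<delta> \<zeta> \<in> D" for \<zeta> using d by (simp add: \<delta>_def inv_into_into)
      have \<delta>z: "\<delta> (z \<alpha>) = \<alpha>" if "\<alpha> \<in> D" for \<alpha> using that z(1) by (simp add: \<delta>_def)
      define fr where "fr v = f (\<delta> (h i (g v))) v" for v
      \<comment> \<open>\<open>F\<close> has the same kernel as \<open>fr\<close> but takes values
        in \<open>'a set\<close>.\<close>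
      define F where "F v = {w. fr w = fr v}" for v
      have F_eq: "F v = F w \<longleftrightarrow> fr v = fr w" for v w by (auto simp: F_def)
      have "\<forall>\<zeta>\<in>L. inj_on F {v \<in> L. h i (g v) = \<zeta>}"
        using f \<delta>D by (auto simp: inj_on_def F_eq fr_def)
      then obtain C where C: "\<forall>\<zeta>\<in>L. C \<zeta> \<in> J" "inj_on F {v \<in> L. h i (g v) \<in> L \<and> v \<in> C (h i (g v))}"
        using Jsel[rule_format, of F "h i"] by blast
      define E where "E \<alpha> = R \<alpha> i \<inter> C (z \<alpha>)" for \<alpha>
      show ?thesis
      proof (intro exI[of _ E] conjI ballI impI)
        show "E \<alpha> \<in> p \<alpha>" if "\<alpha> \<in> D" for \<alpha>
        proof -
          have "R \<alpha> i \<in> p \<alpha>" "C (z \<alpha>) \<in> p \<alpha>" using p(2) i(1) C(1) z(2) that by blast+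
          then show ?thesis using p(1) unfolding E_def ultrafilter_on_def by blast
        qed
        fix \<alpha> \<beta> v w
        assume *: "\<alpha> \<in> D" "\<beta> \<in> D" "v \<in> E \<alpha>" "w \<in> E \<beta>" "f \<alpha> v = f \<beta> w"
        have v: "v \<in> L" "h i (g v) = z \<alpha>" "v \<in> C (z \<alpha>)" and w: "w \<in> L" "h i (g w) = z \<beta>" "w \<in> C (z \<beta>)"
          using * i(2) by (auto simp: E_def R_def)
        have "F v = F w" using * v w \<delta>z by (simp add: F_eq fr_def)
        moreover have "z \<alpha> \<in> L" "z \<beta> \<in> L" using z(2) *(1,2) by auto
        ultimately have "v = w"
          using v w by (intro inj_onD[OF C(2)]) simp_all
        then have "z \<alpha> = z \<beta>" using v w by simp
        then show "\<alpha> = \<beta>" using inj_onD[OF z(1)] *(1,2) by blast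
      qed
    qed simp
  qed
qed

subsection \<open>The space of nodes\<close>

text \<open>\<open>Limit j A\<close> is a limit point of the family \<open>A\<close>; the index \<open>j\<close> provides
  many limit points for the same family.\<close>

datatype 'a node = Free 'a | Limit "'a set set" "'a \<Rightarrow> 'a node"

text \<open>A path that reaches a free node stays there, whence the exception in
  \<open>subterm_self\<close>.\<close>

primrec subterm :: "'a node \<Rightarrow> 'a list \<Rightarrow> 'a node" where
  "subterm (Free a) = (\<lambda>l. Free a)"
| "subterm (Limit j A) = (\<lambda>l. case l of [] \<Rightarrow> Limit j A | x # xs \<Rightarrow> subterm (A x) xs)"

primrec label :: "'a node \<Rightarrow> 'a + 'a set set" where
  "label (Free a) = Inl a"
| "label (Limit j A) = Inr j"

text \<open>The fixed value \<open>Free x0\<close> outside \<open>L\<close> makes a limit node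
  depend only on its index and its family on \<open>L\<close>.\<close>

inductive_set nodes :: "'a set \<Rightarrow> 'a \<Rightarrow> 'a node set" for L x0 where
  Free: "a \<in> L \<Longrightarrow> Free a \<in> nodes L x0"
| Limit: "j \<in> Pow (Pow L) \<Longrightarrow> (\<And>x. A x \<in> nodes L x0) \<Longrightarrow> inj_on A L \<Longrightarrow> (\<And>x. x \<notin> L \<Longrightarrow> A x = Free x0)
    \<Longrightarrow> Limit j A \<in> nodes L x0"

lemma nodes_LimitD:
  assumes "Limit j A \<in> nodes L x0"
  shows "j \<in> Pow (Pow L)" "A x \<in> nodes L x0" "inj_on A L" "x \<notin> L \<Longrightarrow> A x = Free x0"
  using assms unfolding nodes.simps[of "Limit j A"] by simp_all

lemma subterm_Nil [simp]: "subterm t [] = t"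
  by (cases t) auto

lemma subterm_append: "subterm t (l @ l') = subterm (subterm t l) l'"
proof (induction l arbitrary: t)
  case (Cons x xs)
  then show ?case by (cases t) auto
qed simp

text \<open>A nonempty path from \<open>Limit j A\<close> to itself, started one step later, leads
  from a child back to that child. By induction the child is free and cannot lead to a limit
  node.\<close>

lemma subterm_self: "subterm t l = t \<Longrightarrow> l = [] \<or> (\<exists>a. t = Free a)"
proof (induction t arbitrary: l)
  case (Limit j A)
  show ?case
  proof (cases l)
    case (Cons x xs)
    then have *: "subterm (A x) xs = Limit j A" using Limit.prems by simp
    then have "subterm (A x) (xs @ [x]) = A x" by (simp add: subterm_append)
    then obtain a where "A x = Free a" using Limit.IH[of "A x" "xs @ [x]"] by auto
    with * show ?thesis by simp
  qed simp
qed simp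

lemma subterm_antisym:
  assumes "subterm t l = t'" "subterm t' l' = t"
  shows "t = t'"
proof -
  have "subterm t (l @ l') = t" using assms by (simp add: subterm_append)
  then consider "l = []" | a where "t = Free a" using subterm_self by blast
  then show ?thesis using assms by cases auto
qed

lemma subterm_in_nodes: "t \<in> nodes L x0 \<Longrightarrow> subterm t l \<in> nodes L x0"
proof (induction l arbitrary: t)
  case (Cons x xs)
  then show ?case by (cases t) (auto dest: nodes_LimitD)
qed simp

lemma label_in: "t \<in> nodes L x0 \<Longrightarrow> label t \<in> L <+> Pow (Pow L)"
  by (cases rule: nodes.cases) auto

lemma nodes_eqI:
  assumes "t \<in> nodes L x0" "t' \<in> nodes L x0"
    "\<And>l. l \<in> lists L \<Longrightarrow> label (subterm t l) = label (subterm t' l)"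
  shows "t = t'"
  using assms
proof (induction arbitrary: t' rule: nodes.induct)
  case (Free a)
  then show ?case using Free.prems(2)[of "[]"] by (cases t') auto
next
  case (Limit j A)
  obtain A' where t': "t' = Limit j A'"
    using Limit.prems(2)[of "[]"] by (cases t') auto
  note D = nodes_LimitD[OF Limit.prems(1)[unfolded t']]
  have "A x = A' x" for x
  proof (cases "x \<in> L")
    case True
    show ?thesis
    proof (rule Limit.IH)
      show "A' x \<in> nodes L x0" by (rule D)
      show "label (subterm (A x) l) = label (subterm (A' x) l)" if "l \<in> lists L" for l
        using Limit.prems(2)[of "x # l"] True that by (simp add: t')
    qed
  next
    case False
    then show ?thesis using D(4) Limit.hyps by simp
  qed
  then show ?case by (auto simp: t')
qed

text \<open>The labels along paths over \<open>L\<close> determine a node, which bounds the number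
  of nodes by \<open>(2^(2^k))^k = 2^(2^k)\<close> for \<open>k = |L|\<close>. Here \<open>c\<close>
  codes labels as sets of subsets of \<open>L\<close>, and \<open>d\<close> merges a path and a
  subset into one subset. The nodes \<open>Limit j A\<close> with fixed \<open>A\<close> give the
  lower bound.\<close>

lemma card_of_nodes:
  fixes L :: "'a set"
  assumes inf: "infinite L" and x0: "x0 \<in> L"
  shows "|nodes L x0| =o |Pow (Pow L)|"
proof -
  let ?\<Theta> = "Pow (Pow L)"
  have infP: "infinite (Pow L)" and inf\<Theta>: "infinite ?\<Theta>" using inf by (simp_all add: finite_Pow_iff)
  have LP: "|L| \<le>o |Pow L|" and P\<Theta>: "|Pow L| \<le>o |?\<Theta>|"
    by (simp_all add: card_of_Pow ordLess_imp_ordLeq)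
  have "|L <+> ?\<Theta>| \<le>o |?\<Theta>|"
    using card_of_Plus_infinite2[OF inf\<Theta>] LP P\<Theta> ordLeq_transitive ordIso_imp_ordLeq by blast
  then obtain c where c: "inj_on c (L <+> ?\<Theta>)" "c ` (L <+> ?\<Theta>) \<subseteq> ?\<Theta>"
    by (rule card_of_ordLeqE)
  have "|lists L \<times> Pow L| \<le>o |Pow L|"
    using card_of_lists_ordLeq[OF inf] LP ordLeq_transitive
    by (intro card_of_Times_ordLeq_infinite infP card_ordLeq_refl) blast
  then obtain d where d: "inj_on d (lists L \<times> Pow L)" "d ` (lists L \<times> Pow L) \<subseteq> Pow L"
    by (rule card_of_ordLeqE)
  define F where "F t = d ` (SIGMA l:lists L. c (label (subterm t l)))" for t
  have cP: "c (label (subterm t l)) \<subseteq> Pow L" if "t \<in> nodes L x0" for t l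
    using c(2) label_in[OF subterm_in_nodes[OF that]] by blast
  have sub: "(SIGMA l:lists L. c (label (subterm t l))) \<subseteq> lists L \<times> Pow L" if "t \<in> nodes L x0" for t
    by (intro Sigma_mono order_refl cP that)
  have "inj_on F (nodes L x0)"
  proof (rule inj_onI)
    fix t t' assume t: "t \<in> nodes L x0" "t' \<in> nodes L x0" "F t = F t'"
    then have "(SIGMA l:lists L. c (label (subterm t l))) = (SIGMA l:lists L. c (label (subterm t' l)))"
      unfolding F_def using inj_on_image_eq_iff[OF d(1) sub[OF t(1)] sub[OF t(2)]] by simp
    then have "c (label (subterm t l)) = c (label (subterm t' l))" if "l \<in> lists L" for l
      using that by (auto simp: set_eq_iff)
    then have "label (subterm t l) = label (subterm t' l)" if "l \<in> lists L" for l
      using that label_in[OF subterm_in_nodes[OF t(1)]] label_in[OF subterm_in_nodes[OF t(2)]]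
      by (intro inj_onD[OF c(1)])
    then show "t = t'" by (rule nodes_eqI[OF t(1,2)])
  qed
  moreover have "F ` nodes L x0 \<subseteq> ?\<Theta>"
  proof (intro image_subsetI PowI)
    show "F t \<subseteq> Pow L" if "t \<in> nodes L x0" for t
      unfolding F_def using image_mono[OF sub[OF that], of d] d(2) by (rule order_trans)
  qed
  ultimately have 1: "|nodes L x0| \<le>o |?\<Theta>|"
    by (rule card_of_ordLeqI)
  define A where "A x = (if x \<in> L then Free x else Free x0)" for x
  have "inj_on (\<lambda>j. Limit j A) ?\<Theta>" by (simp add: inj_on_def)
  moreover have "(\<lambda>j. Limit j A) ` ?\<Theta> \<subseteq> nodes L x0"
    using x0 by (auto simp: A_def inj_on_def intro!: nodes.intros)
  ultimately have "|?\<Theta>| \<le>o |nodes L x0|"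
    by (rule card_of_ordLeqI)
  with 1 show ?thesis by (simp add: ordIso_iff_ordLeq)
qed

section \<open>Clopen cones and the separation of points\<close>

inductive_set cone :: "'a node \<Rightarrow> ('a node \<Rightarrow> 'a set) \<Rightarrow> 'a node set" for y E where
  base: "y \<in> cone y E"
| step: "Limit j A \<in> cone y E \<Longrightarrow> \<xi> \<in> E (Limit j A) \<Longrightarrow> A \<xi> \<in> cone y E"

text \<open>At limit nodes outside \<open>Z\<close> the value is defined by the ultrafilter
  condition, which therefore has to be verified on \<open>Z\<close> only.\<close>

primrec extend :: "'a set \<Rightarrow> ('a node \<Rightarrow> 'a set set) \<Rightarrow> 'a node set \<Rightarrow> 'a node set \<Rightarrow> 'a node \<Rightarrow> bool" where
  "extend L P Z K (Free a) \<longleftrightarrow> Free a \<in> K"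
| "extend L P Z K (Limit j A) \<longleftrightarrow>
     (if Limit j A \<in> Z then Limit j A \<in> K else {\<xi> \<in> L. extend L P Z K (A \<xi>)} \<in> P (Limit j A))"

text \<open>The bijection \<open>b\<close> has two roles: it assigns to each node \<open>t\<close>
  its own ultrafilter \<open>p (b t)\<close>, and it transports the topology to
  \<open>Pow (Pow L)\<close>.\<close>

locale limit_nodes =
  fixes L :: "'a set" and x0 :: 'a and p :: "'a set set \<Rightarrow> 'a set set" and b :: "'a node \<Rightarrow> 'a set set"
  assumes inf: "infinite L" and x0: "x0 \<in> L"
    and ultra: "\<alpha> \<in> Pow (Pow L) \<Longrightarrow> ultrafilter_on L (p \<alpha>)"
    and free: "\<alpha> \<in> Pow (Pow L) \<Longrightarrow> x \<in> L \<Longrightarrow> L - {x} \<in> p \<alpha>"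
    and disjointing: "D \<subseteq> Pow (Pow L) \<Longrightarrow> |D| \<le>o |L| \<Longrightarrow> \<forall>\<alpha>\<in>D. inj_on (f \<alpha> :: 'a \<Rightarrow> 'a node) L \<Longrightarrow>
        \<exists>E. (\<forall>\<alpha>\<in>D. E \<alpha> \<in> p \<alpha>) \<and>
             (\<forall>\<alpha>\<in>D. \<forall>\<beta>\<in>D. \<forall>v\<in>E \<alpha>. \<forall>w\<in>E \<beta>. f \<alpha> v = f \<beta> w \<longrightarrow> \<alpha> = \<beta>)"
    and b: "bij_betw b (nodes L x0) (Pow (Pow L))"
begin

abbreviation "T \<equiv> nodes L x0"

text \<open>These are the predicates of the basic clopen sets; free nodes are unconstrained.\<close>

definition good :: "('a node \<Rightarrow> bool) \<Rightarrow> bool" where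
  "good f \<longleftrightarrow> (\<forall>j A. Limit j A \<in> T \<longrightarrow> (f (Limit j A) \<longleftrightarrow> {\<xi> \<in> L. f (A \<xi>)} \<in> p (b (Limit j A))))"

lemma b_in: "t \<in> T \<Longrightarrow> b t \<in> Pow (Pow L)"
  using b bij_betwE by blast

lemma ultra_b: "t \<in> T \<Longrightarrow> ultrafilter_on L (p (b t))"
  using ultra b_in by blast

lemma L_in: "t \<in> T \<Longrightarrow> L \<in> p (b t)"
  using ultrafilter_on_mono[OF ultra_b free[OF b_in x0]] by blast

lemma good_True: "good (\<lambda>_. True)"
  using L_in by (simp add: good_def)

lemma good_not: "good f \<Longrightarrow> good (\<lambda>t. \<not> f t)"
  unfolding good_def
proof (intro allI impI)
  fix j A
  assume f: "\<forall>j A. Limit j A \<in> T \<longrightarrow> f (Limit j A) = ({\<xi> \<in> L. f (A \<xi>)} \<in> p (b (Limit j A)))"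
    and t: "Limit j A \<in> T"
  have "{\<xi> \<in> L. \<not> f (A \<xi>)} = L - {\<xi> \<in> L. f (A \<xi>)}" by auto
  then show "(\<not> f (Limit j A)) = ({\<xi> \<in> L. \<not> f (A \<xi>)} \<in> p (b (Limit j A)))"
    using f t ultrafilter_on_Diff_iff[OF ultra_b[OF t], of "{\<xi> \<in> L. f (A \<xi>)}"] by auto
qed

lemma good_conj: "good f \<Longrightarrow> good g \<Longrightarrow> good (\<lambda>t. f t \<and> g t)"
  unfolding good_def
proof (intro allI impI)
  fix j A
  assume f: "\<forall>j A. Limit j A \<in> T \<longrightarrow> f (Limit j A) = ({\<xi> \<in> L. f (A \<xi>)} \<in> p (b (Limit j A)))"
    and g: "\<forall>j A. Limit j A \<in> T \<longrightarrow> g (Limit j A) = ({\<xi> \<in> L. g (A \<xi>)} \<in> p (b (Limit j A)))"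
    and t: "Limit j A \<in> T"
  have "{\<xi> \<in> L. f (A \<xi>) \<and> g (A \<xi>)} = {\<xi> \<in> L. f (A \<xi>)} \<inter> {\<xi> \<in> L. g (A \<xi>)}" by auto
  then show "(f (Limit j A) \<and> g (Limit j A)) = ({\<xi> \<in> L. f (A \<xi>) \<and> g (A \<xi>)} \<in> p (b (Limit j A)))"
    using f g t ultrafilter_on_Int_iff[OF ultra_b[OF t], of "{\<xi> \<in> L. f (A \<xi>)}" "{\<xi> \<in> L. g (A \<xi>)}"]
    by auto
qed

text \<open>The cone of \<open>y\<close> is clopen: by disjointness a node outside it meets it in at most the point \<open>y\<close>
  itself, up to a set that its ultrafilter ignores.\<close>

lemma good_separating:
  assumes y: "y \<in> T" and z: "z \<in> T" and not_sub: "\<And>l. subterm y l \<noteq> z"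
  shows "\<exists>f. good f \<and> f y \<and> \<not> f z"
proof -
  \<comment> \<open>At most \<open>|L|\<close> nodes, closed under passing to the members of a
    family, so that \<open>disjointing\<close> applies to its limit nodes.\<close>
  define Z where "Z = subterm y ` lists L \<union> subterm z ` lists L"
  have ZT: "Z \<subseteq> T" using subterm_in_nodes y z by (auto simp: Z_def)
  have Z_card: "|Z| \<le>o |L|"
    unfolding Z_def
  proof (rule Un_Cinfinite_bound)
    show "|subterm t ` lists L| \<le>o |L|" for t
      using card_of_image card_of_lists_ordLeq[OF inf] ordLeq_transitive by blast
    then show "|subterm z ` lists L| \<le>o |L|" .
    show "Cinfinite |L|"
      by (intro conjI card_of_Card_order) (simp add: cinfinite_def Field_card_of inf)
  qed
  define seq where "seq t = (case t of Free a \<Rightarrow> undefined | Limit j A \<Rightarrow> A)" for t :: "'a node"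
  define M where "M = {t \<in> Z. \<exists>j A. t = Limit j A}"
  define D where "D = b ` M"
  have MT: "M \<subseteq> T" using ZT by (auto simp: M_def)
  have inv: "inv_into T b (b t) = t" if "t \<in> T" for t
    using b that by (simp add: bij_betw_inv_into_left)
  have D1: "D \<subseteq> Pow (Pow L)" using b_in MT unfolding D_def by blast
  have "M \<subseteq> Z" by (auto simp: M_def)
  then have "|M| \<le>o |L|" using Z_card ordLeq_transitive card_of_mono1 by blast
  then have D2: "|D| \<le>o |L|" unfolding D_def by (rule ordLeq_transitive[OF card_of_image])
  have D3: "\<forall>\<alpha>\<in>D. inj_on (seq (inv_into T b \<alpha>)) L"
  proof
    fix \<alpha> assume "\<alpha> \<in> D"
    then obtain j A where t: "Limit j A \<in> M" "\<alpha> = b (Limit j A)" by (auto simp: D_def M_def)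
    then have "Limit j A \<in> T" using MT by blast
    then show "inj_on (seq (inv_into T b \<alpha>)) L"
      using inv[of "Limit j A"] nodes_LimitD(3)[of j A] by (simp add: seq_def t(2))
  qed
  obtain E where E: "\<forall>\<alpha>\<in>D. E \<alpha> \<in> p \<alpha>"
    and disj: "\<forall>\<alpha>\<in>D. \<forall>\<beta>\<in>D. \<forall>v\<in>E \<alpha>. \<forall>w\<in>E \<beta>. seq (inv_into T b \<alpha>) v = seq (inv_into T b \<beta>) w \<longrightarrow> \<alpha> = \<beta>"
    using disjointing[OF D1 D2 D3] by blast
  have ME: "E (b t) \<in> p (b t)" if "t \<in> M" for t using E that by (auto simp: D_def)
  have MEL: "E (b t) \<subseteq> L" if "t \<in> M" for t
    using ME[OF that] ultra_b[of t] MT that unfolding ultrafilter_on_def by blast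
  have Mdisj: "s = t" if "s \<in> M" "t \<in> M" "v \<in> E (b s)" "w \<in> E (b t)" "seq s v = seq t w" for s t v w
  proof -
    have s: "inv_into T b (b s) = s" and t: "inv_into T b (b t) = t"
      using inv MT that(1,2) by blast+
    have D: "b s \<in> D" "b t \<in> D" using that(1,2) by (simp_all add: D_def)
    have "seq (inv_into T b (b s)) v = seq (inv_into T b (b t)) w" unfolding s t by (rule that(5))
    then have "b s = b t" by (rule disj[rule_format, OF D that(3,4)])
    then show ?thesis using s t by metis
  qed
  have child: "A \<xi> \<in> subterm u ` lists L" if *: "Limit j A \<in> subterm u ` lists L" "\<xi> \<in> L" for j A \<xi> u
  proof -
    obtain l where "l \<in> lists L" "subterm u l = Limit j A" using *(1) by (metis imageE)
    then have "subterm u (l @ [\<xi>]) = A \<xi>" "l @ [\<xi>] \<in> lists L" using *(2) by (simp_all add: subterm_append)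
    then show ?thesis by (metis imageI)
  qed
  \<comment> \<open>Intersecting with \<open>L\<close> keeps the cone among subterms along paths
    over \<open>L\<close> even where \<open>E\<close> is unspecified.\<close>
  define K where "K = cone y (\<lambda>t. E (b t) \<inter> L)"
  have Ky: "t \<in> subterm y ` lists L" if "t \<in> K" for t
    using that unfolding K_def
  proof (induction rule: cone.induct)
    case base
    show ?case using image_eqI[of y "subterm y" "[]"] by simp
  next
    case (step j A \<xi>)
    then show ?case using child by blast
  qed
  have KZ: "K \<subseteq> Z" using Ky by (auto simp: Z_def)
  have yK: "y \<in> K" unfolding K_def by (rule cone.base)
  have zK: "z \<notin> K" using Ky not_sub by blast
  have zZ: "z \<in> Z" using image_eqI[of z "subterm z" "[]" "lists L"] by (simp add: Z_def)
  define f where "f = extend L (\<lambda>t. p (b t)) Z K"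
  have fZ: "f t \<longleftrightarrow> t \<in> K" if "t \<in> Z" for t
    using that by (cases t) (simp_all add: f_def)
  have "good f"
    unfolding good_def
  proof (intro allI impI)
    fix j A assume t: "Limit j A \<in> T"
    let ?t = "Limit j A" and ?W = "{\<xi> \<in> L. f (A \<xi>)}"
    show "f ?t \<longleftrightarrow> ?W \<in> p (b ?t)"
    proof (cases "?t \<in> Z")
      case False
      then show ?thesis by (simp add: f_def)
    next
      case True
      then have tM: "?t \<in> M" by (simp add: M_def)
      have AZ: "A \<xi> \<in> Z" if "\<xi> \<in> L" for \<xi>
        using True child that unfolding Z_def by blast
      have W: "?W = {\<xi> \<in> L. A \<xi> \<in> K}" using fZ AZ by auto
      show ?thesis
      proof (cases "?t \<in> K")
        case True
        have "E (b ?t) \<subseteq> ?W"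
        proof
          fix \<xi> assume "\<xi> \<in> E (b ?t)"
          moreover from this have "\<xi> \<in> L" using MEL[OF tM] by blast
          ultimately have "A \<xi> \<in> K" using True unfolding K_def by (intro cone.step) auto
          with \<open>\<xi> \<in> L\<close> show "\<xi> \<in> ?W" unfolding W by simp
        qed
        then have "?W \<in> p (b ?t)"
          using ultrafilter_on_mono[OF ultra_b[OF t] ME[OF tM]] by blast
        then show ?thesis using True fZ \<open>?t \<in> Z\<close> by blast
      next
        case False
        \<comment> \<open>By injectivity of \<open>A\<close> at most one index is mapped to the root
          \<open>y\<close>, and the ultrafilter contains its complement.\<close>
        have "{\<xi> \<in> L. A \<xi> \<noteq> y} \<in> p (b ?t)"
        proof (cases "\<exists>\<xi>\<in>L. A \<xi> = y")
          case True
          then obtain \<xi> where \<xi>: "\<xi> \<in> L" "A \<xi> = y" by blast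
          then have "{\<xi> \<in> L. A \<xi> \<noteq> y} = L - {\<xi>}"
            using nodes_LimitD(3)[OF t] by (auto simp: inj_on_def)
          then show ?thesis using free[OF b_in[OF t] \<xi>(1)] by simp
        next
          case False
          then have "{\<xi> \<in> L. A \<xi> \<noteq> y} = L" by auto
          then show ?thesis using L_in[OF t] by simp
        qed
        then have V: "E (b ?t) \<inter> {\<xi> \<in> L. A \<xi> \<noteq> y} \<in> p (b ?t)" (is "?V \<in> _")
          using ME[OF tM] ultra_b[OF t] unfolding ultrafilter_on_def by blast
        have "?V \<subseteq> L - ?W"
        proof
          fix \<xi> assume \<xi>: "\<xi> \<in> ?V"
          \<comment> \<open>A node of the cone other than \<open>y\<close> was entered from a parent
            in the cone; disjointness identifies this parent with \<open>?t\<close>, which lies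
            outside.\<close>
          have "A \<xi> \<notin> K"
          proof
            assume "A \<xi> \<in> K"
            then obtain j' A' \<xi>' where *: "Limit j' A' \<in> K" "\<xi>' \<in> E (b (Limit j' A'))" "A \<xi> = A' \<xi>'"
              using \<xi> unfolding K_def by (cases rule: cone.cases) auto
            have "Limit j' A' \<in> M" using * KZ by (auto simp: M_def)
            then have "Limit j' A' = ?t"
              using Mdisj[OF _ tM, of "Limit j' A'" \<xi>' \<xi>] * \<xi> by (simp add: seq_def)
            with * False show False by simp
          qed
          with \<xi> show "\<xi> \<in> L - ?W" unfolding W by simp
        qed
        then have "L - ?W \<in> p (b ?t)"
          using ultrafilter_on_mono[OF ultra_b[OF t] V] by blast
        then have "?W \<notin> p (b ?t)" using ultrafilter_on_Diff_iff[OF ultra_b[OF t], of ?W] by auto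
        then show ?thesis using False fZ \<open>?t \<in> Z\<close> by blast
      qed
    qed
  qed
  then show ?thesis using fZ yK zK zZ KZ by blast
qed

text \<open>By antisymmetry one of the nodes is not a subterm of the other; complements handle both
  orders.\<close>

lemma good_separates_points:
  assumes "y \<in> T" "z \<in> T" "y \<noteq> z"
  shows "\<exists>f. good f \<and> f y \<and> \<not> f z"
proof (cases "\<exists>l. subterm y l = z")
  case False
  then show ?thesis using good_separating assms by blast
next
  case True
  then have "\<And>l. subterm z l \<noteq> y" using subterm_antisym assms by metis
  then obtain f where "good f" "f z" "\<not> f y" using good_separating[OF assms(2,1)] by blast
  then show ?thesis using good_not by (intro exI[of _ "\<lambda>t. \<not> f t"]) simp
qed

section \<open>The topology with the good predicates as clopen basis\<close>

definition base_set :: "('a node \<Rightarrow> bool) \<Rightarrow> 'a set set set" where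
  "base_set f = b ` {t \<in> T. f t}"

definition node_space :: "'a set set topology" where
  "node_space = topology (arbitrary union_of (\<lambda>U. U \<in> base_set ` Collect good))"

lemma mem_base_set: "t \<in> T \<Longrightarrow> b t \<in> base_set f \<longleftrightarrow> f t"
  using b by (auto simp: base_set_def bij_betw_def inj_on_def)

lemma b_surj: "\<alpha> \<in> Pow (Pow L) \<Longrightarrow> \<exists>t\<in>T. \<alpha> = b t"
  using b unfolding bij_betw_def by (metis imageE)

lemma base_set_sub: "base_set f \<subseteq> Pow (Pow L)"
  using b by (auto simp: base_set_def bij_betw_def)

lemma openin_node_space: "openin node_space = arbitrary union_of (\<lambda>U. U \<in> base_set ` Collect good)"
  unfolding node_space_def
proof (rule topology_inverse', rule istopology_base)
  fix U V assume "U \<in> base_set ` Collect good" "V \<in> base_set ` Collect good"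
  then obtain f g where fg: "good f" "good g" "U = base_set f" "V = base_set g" by blast
  have "U \<inter> V = base_set (\<lambda>t. f t \<and> g t)"
    using b unfolding fg base_set_def bij_betw_def by (auto simp: inj_on_def)
  then show "U \<inter> V \<in> base_set ` Collect good" using good_conj fg by blast
qed

lemma openin_base_set: "good f \<Longrightarrow> openin node_space (base_set f)"
  unfolding openin_node_space by (intro union_of_inc) (auto simp: arbitrary_def)

lemma openin_node_space_iff:
  "openin node_space U \<longleftrightarrow> (\<forall>x\<in>U. \<exists>f. good f \<and> x \<in> base_set f \<and> base_set f \<subseteq> U)"
  unfolding openin_node_space arbitrary_union_of_alt by auto

lemma topspace_node_space: "topspace node_space = Pow (Pow L)"
proof
  show "topspace node_space \<subseteq> Pow (Pow L)"
    using openin_topspace[of node_space] base_set_sub unfolding openin_node_space_iff by blast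
  have "base_set (\<lambda>_. True) = Pow (Pow L)" using b by (simp add: base_set_def bij_betw_def)
  then show "Pow (Pow L) \<subseteq> topspace node_space"
    using openin_subset[OF openin_base_set[OF good_True]] by simp
qed

lemma closedin_base_set:
  assumes "good f"
  shows "closedin node_space (base_set f)"
proof -
  have "topspace node_space - base_set f = base_set (\<lambda>t. \<not> f t)"
  proof (rule set_eqI)
    fix \<alpha>
    show "\<alpha> \<in> topspace node_space - base_set f \<longleftrightarrow> \<alpha> \<in> base_set (\<lambda>t. \<not> f t)"
    proof (cases "\<alpha> \<in> Pow (Pow L)")
      case True
      then obtain t where "t \<in> T" "\<alpha> = b t" using b_surj by metis
      then show ?thesis using True by (simp add: mem_base_set topspace_node_space del: Pow_iff)
    next
      case False
      then have "\<alpha> \<notin> topspace node_space" "\<alpha> \<notin> base_set (\<lambda>t. \<not> f t)"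
        using subsetD[OF base_set_sub] unfolding topspace_node_space by metis+
      then show ?thesis by simp
    qed
  qed
  then show ?thesis
    using openin_base_set[OF good_not[OF assms]] base_set_sub[of f] unfolding closedin_def topspace_node_space by simp
qed

lemma has_clopen_basis_node_space: "has_clopen_basis node_space"
  unfolding has_clopen_basis_def
  using openin_base_set closedin_base_set openin_node_space
  by (intro exI[of _ "base_set ` Collect good"]) auto

text \<open>Regularity comes from the clopen basis; only the separation of points needs the
  cones.\<close>

lemma T3_node_space: "T3_space node_space"
  unfolding T3_space_def
proof
  show "t1_space node_space"
    unfolding t1_space_def topspace_node_space
  proof (intro ballI impI)
    fix \<alpha> \<beta> assume "\<alpha> \<in> Pow (Pow L)" "\<beta> \<in> Pow (Pow L)" "\<alpha> \<noteq> \<beta>"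
    then obtain s t where st: "s \<in> T" "t \<in> T" "\<alpha> = b s" "\<beta> = b t" "s \<noteq> t" using b_surj by metis
    then obtain f where "good f" "f s" "\<not> f t" using good_separates_points by metis
    then show "\<exists>U. openin node_space U \<and> \<alpha> \<in> U \<and> \<beta> \<notin> U"
      using openin_base_set mem_base_set st by metis
  qed
  show "regular_space node_space"
    unfolding regular_space_def
  proof (intro allI impI)
    fix C a assume *: "closedin node_space C \<and> a \<in> topspace node_space - C"
    then have "openin node_space (topspace node_space - C)" by blast
    then obtain f where f: "good f" "a \<in> base_set f" "base_set f \<subseteq> topspace node_space - C"
      using * unfolding openin_node_space_iff by blast
    show "\<exists>U V. openin node_space U \<and> openin node_space V \<and> a \<in> U \<and> C \<subseteq> V \<and> disjnt U V"
    proof (intro exI conjI)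
      show "openin node_space (base_set f)" by (rule openin_base_set[OF f(1)])
      show "openin node_space (topspace node_space - base_set f)" using closedin_base_set[OF f(1)] by blast
      show "a \<in> base_set f" by (rule f(2))
      show "C \<subseteq> topspace node_space - base_set f" using f(3) closedin_subset[of node_space C] * by blast
      show "disjnt (base_set f) (topspace node_space - base_set f)" by (auto simp: disjnt_def)
    qed
  qed
qed

text \<open>An injective family \<open>A\<close> of nodes in \<open>Y\<close> has the limit points
  \<open>Limit j A\<close> for all \<open>j\<close>: a basic neighbourhood of such a node contains
  \<open>A \<xi>\<close> for ultrafilter-many \<open>\<xi>\<close>, in particular for one, so it
  meets \<open>Y\<close>.\<close>

lemma card_of_closed:
  assumes Y: "closedin node_space Y" and card: "|L| \<le>o |Y|"
  shows "|Y| =o |topspace node_space|"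
proof -
  obtain a where a: "inj_on a L" "a ` L \<subseteq> Y" by (rule card_of_ordLeqE[OF card])
  have Y\<Theta>: "Y \<subseteq> Pow (Pow L)" using closedin_subset[OF Y] by (simp add: topspace_node_space)
  define A where "A x = (if x \<in> L then inv_into T b (a x) else Free x0)" for x
  have A: "A x \<in> T" "b (A x) = a x" if "x \<in> L" for x
  proof -
    have "a x \<in> Y" using a(2) that by auto
    then have "a x \<in> b ` T" unfolding bij_betw_imp_surj_on[OF b] by (rule subsetD[OF Y\<Theta>])
    then show "A x \<in> T" "b (A x) = a x"
      using that by (simp_all add: A_def inv_into_into f_inv_into_f)
  qed
  have injA: "inj_on A L"
    using a(1) A(2) unfolding inj_on_def by metis
  have LimT: "Limit j A \<in> T" if "j \<in> Pow (Pow L)" for j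
  proof (rule nodes.Limit[OF that _ injA])
    show "A x \<in> T" for x using A(1) nodes.Free[OF x0] by (cases "x \<in> L") (auto simp: A_def)
    show "A x = Free x0" if "x \<notin> L" for x using that by (simp add: A_def)
  qed
  have LimY: "b (Limit j A) \<in> Y" if j: "j \<in> Pow (Pow L)" for j
  proof (rule ccontr)
    assume "b (Limit j A) \<notin> Y"
    then have "b (Limit j A) \<in> topspace node_space - Y" using b_in[OF LimT[OF j]] by (simp add: topspace_node_space)
    moreover have "openin node_space (topspace node_space - Y)" using Y by blast
    ultimately obtain f where f: "good f" "b (Limit j A) \<in> base_set f" "base_set f \<subseteq> topspace node_space - Y"
      unfolding openin_node_space_iff by blast
    have "{\<xi> \<in> L. f (A \<xi>)} \<in> p (b (Limit j A))"
      using f mem_base_set LimT[OF j] unfolding good_def by blast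
    moreover have "{} \<notin> p (b (Limit j A))" using ultra_b[OF LimT[OF j]] by (simp add: ultrafilter_on_def)
    ultimately obtain \<xi> where \<xi>: "\<xi> \<in> L" "f (A \<xi>)" by (metis (no_types, lifting) Collect_empty_eq)
    then have "a \<xi> \<in> base_set f" using mem_base_set A by metis
    then show False using f(3) a(2) \<xi>(1) by blast
  qed
  have "inj_on (\<lambda>j. b (Limit j A)) (Pow (Pow L))"
  proof (rule inj_onI)
    fix i j assume "i \<in> Pow (Pow L)" "j \<in> Pow (Pow L)" "b (Limit i A) = b (Limit j A)"
    then have "Limit i A = Limit j A" using LimT b by (auto simp: bij_betw_def dest: inj_onD)
    then show "i = j" by simp
  qed
  then have "|Pow (Pow L)| \<le>o |Y|"
    using LimY by (intro card_of_ordLeqI) auto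
  moreover have "|Y| \<le>o |Pow (Pow L)|" using Y\<Theta> by (rule card_of_mono1)
  ultimately show ?thesis by (simp add: topspace_node_space ordIso_iff_ordLeq)
qed

end

text \<open>The construction is applied to \<open>L = Field \<kappa>\<close>; transport along
  \<open>b\<close> gives the points the type \<open>'a set set\<close>.\<close>

theorem theorem0p1:
  fixes \<kappa> :: "'a rel"
  assumes "Card_order \<kappa>" and "cinfinite \<kappa>"
  shows "\<exists>X :: 'a set set topology.
           T3_space X \<and> has_clopen_basis X \<and>
           |topspace X| =o ctwo ^c (ctwo ^c \<kappa>) \<and>
           (\<forall>Y. closedin X Y \<and> \<kappa> \<le>o |Y| \<longrightarrow> |Y| =o |topspace X| )"
proof -
  define L where "L = Field \<kappa>"
  have inf: "infinite L" using assms(2) by (simp add: L_def cinfinite_def)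
  then obtain x0 where x0: "x0 \<in> L" using infinite_imp_nonempty by blast
  have L: "|L| =o \<kappa>" unfolding L_def by (rule card_of_Field_ordIso[OF assms(1)])
  obtain b where b: "bij_betw b (nodes L x0) (Pow (Pow L))"
    using card_of_nodes[OF inf x0] card_of_ordIso by blast
  obtain p :: "'a set set \<Rightarrow> 'a set set" where p:
    "\<forall>\<alpha>\<in>Pow (Pow L). ultrafilter_on L (p \<alpha>) \<and> (\<forall>x\<in>L. L - {x} \<in> p \<alpha>)"
    "\<forall>D (f :: 'a set set \<Rightarrow> 'a \<Rightarrow> 'a node). D \<subseteq> Pow (Pow L) \<longrightarrow> |D| \<le>o |L| \<longrightarrow>
        (\<forall>\<alpha>\<in>D. inj_on (f \<alpha>) L) \<longrightarrow>
        (\<exists>E. (\<forall>\<alpha>\<in>D. E \<alpha> \<in> p \<alpha>) \<and>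
             (\<forall>\<alpha>\<in>D. \<forall>\<beta>\<in>D. \<forall>v\<in>E \<alpha>. \<forall>w\<in>E \<beta>. f \<alpha> v = f \<beta> w \<longrightarrow> \<alpha> = \<beta>))"
    using disjointing_ultrafilters[OF inf] by (elim exE conjE)
  interpret limit_nodes L x0 p b
    by unfold_locales (use inf x0 p(1) p(2)[rule_format] b in simp_all)
  have "|Pow L| =o ctwo ^c \<kappa>"
    using card_of_Pow_Func[of L] by (simp add: L_def cexp_def ctwo_def Field_card_of)
  moreover have "|Pow (Pow L)| =o ctwo ^c |Pow L|"
    using card_of_Pow_Func[of "Pow L"] by (simp add: cexp_def ctwo_def Field_card_of)
  ultimately have "|topspace node_space| =o ctwo ^c (ctwo ^c \<kappa>)"
    unfolding topspace_node_space
    using ordIso_transitive cexp_cong2 Card_order_ctwo Card_order_cexp card_of_Card_order by metis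
  moreover have "|Y| =o |topspace node_space|" if "closedin node_space Y" "\<kappa> \<le>o |Y|" for Y
    using card_of_closed[OF that(1)] ordIso_ordLeq_trans[OF L that(2)] by blast
  ultimately show ?thesis using T3_node_space has_clopen_basis_node_space by blast
qed

end
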